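(* Let $\rho>0$ and let $A=(A_1,\ldots,A_n)\in B(\mathcal H)^n$ be in $\mathcal C_\rho$. Then $A\overset{H}{\prec}0$ if and only if the joint spectral radius satisfies $r(A_1,\ldots,A_n)<1$.
   Context: Let $n\ge1$, $\mathcal H$ a complex Hilbert space, $\mathcal K$ an infinite-dimensional Hilbert space. $\mathbb F_n^+$ is the unital free semigroup on generators $g_1,\ldots,g_n$ with identity $g_0$; $|\alpha|$ is the length of $\alpha$. $T_\alpha:=T_{i_1}\cdots T_{i_k}$ if $\alpha=g_{i_1}\cdots g_{i_k}$, $T_{g_0}:=I$. For $\rho\in(0,\infty)$, $T\in B(\mathcal H)^n$ is in the class $\mathcal C_\rho$ if there exist a Hilbert space $\mathcal G\supseteq\mathcal H$ and isometries $V_1,\ldots,V_n\in B(\mathcal G)$ with mutually orthogonal ranges such that $T_\alpha=\rho P_{\mathcal H}V_\alpha|_{\mathcal H}$ for all $\alpha\in\mathbb F_n^+\setminus\{g_0\}$. The joint spectral radius is $r(T_1,\ldots,T_n):=\lim_{k\to\infty}\big\|\sum_{|\alpha|=k}T_\alpha T_\alpha^*\big\|^{1/2k}$. Harnack domination: for $A,B\in\mathcal C_\rho$, $A\overset{H}{\prec}B$ means that there exists $c>0$ such that $$\Re p(A_1,\ldots,A_n)+(\rho-1)\Re p(0)\le c^2[\Re p(B_1,\ldots,B_n)+(\rho-1)\Re p(0)]$$ for every noncommutative polynomial with matrix coefficients $p\in\mathbb C[X_1,\ldots,X_n]\otimes M_m$, $m\in\mathbb N$, such that $\Re p(X):=\frac12(p(X)^*+p(X))\ge0$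 for all $X\in[B(\mathcal K)^n]_1:=\{X\in B(\mathcal K)^n:\|\sum_iX_iX_i^*\|<1\}$. Here, for $p=\sum_\alpha X_\alpha\otimes M_\alpha$, $p(A)=\sum_\alpha A_\alpha\otimes M_\alpha$. The symbol $0$ denotes the zero $n$-tuple in $B(\mathcal H)^n$. *)

theory Defs
  imports
    "HOL-Analysis.Analysis"
    "Jordan_Normal_Form.Matrix"
begin

(* Complex Hilbert spaces. The library only has real inner product spaces, so a complex Hilbert
   space is a complete real one together with a compatible complex structure. cinner is linear in
   its first argument. Positivity and definiteness of cinner and norm x = sqrt (Re (cinner x x))
   are inherited from real_inner through inner_eq_Re_cinner, since cinner_commute makes
   cinner x x real. *)
class chilbert = real_inner + complete_space +
  fixes scaleC :: "complex \<Rightarrow> 'a \<Rightarrow> 'a"  (infixr "*\<^sub>C" 75)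
    and cinner :: "'a \<Rightarrow> 'a \<Rightarrow> complex"
  assumes scaleC_add_right: "c *\<^sub>C (x + y) = c *\<^sub>C x + c *\<^sub>C y"
    and scaleC_add_left: "(c + d) *\<^sub>C x = c *\<^sub>C x + d *\<^sub>C x"
    and scaleC_scaleC: "c *\<^sub>C (d *\<^sub>C x) = (c * d) *\<^sub>C x"
    and scaleR_scaleC: "r *\<^sub>R x = complex_of_real r *\<^sub>C x"
    and cinner_commute: "cinner x y = cnj (cinner y x)"
    and cinner_add_left: "cinner (x + y) z = cinner x z + cinner y z"
    and cinner_scaleC_left: "cinner (c *\<^sub>C x) y = c * cinner x y"
    and inner_eq_Re_cinner: "x \<bullet> y = Re (cinner x y)"

definition infinite_cdim :: "'k::chilbert itself \<Rightarrow> bool" where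
  "infinite_cdim _ \<longleftrightarrow>
     \<not> (\<exists>S :: 'k set. finite S \<and> module.span scaleC S = UNIV)"

lemma norm_scaleC: "norm (c *\<^sub>C (x :: 'a::chilbert)) = cmod c * norm x"
proof -
  have "cinner (c *\<^sub>C x) (c *\<^sub>C x) = c * cnj (c * cinner x x)"
    by (metis cinner_commute cinner_scaleC_left)
  also have "\<dots> = complex_of_real ((cmod c)\<^sup>2) * cnj (cinner x x)"
    by (simp only: complex_norm_square complex_cnj_mult mult.assoc)
  finally have "(c *\<^sub>C x) \<bullet> (c *\<^sub>C x) = (cmod c)\<^sup>2 * (x \<bullet> x)"
    by (simp add: inner_eq_Re_cinner)
  then have "(norm (c *\<^sub>C x))\<^sup>2 = (cmod c * norm x)\<^sup>2"
    by (simp add: power2_norm_eq_inner power_mult_distrib)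
  then show ?thesis
    by (simp add: power2_eq_iff_nonneg)
qed

(* B(H) and B(H,G): the library type of bounded linear maps is real linear; the members of
   bop are the complex linear ones. *)
definition bop :: "('a::chilbert \<Rightarrow>\<^sub>L 'b::chilbert) set" where
  "bop = {T. \<forall>c x. blinfun_apply T (c *\<^sub>C x) = c *\<^sub>C blinfun_apply T x}"

lift_definition scaleC_op :: "complex \<Rightarrow> ('a::chilbert \<Rightarrow>\<^sub>L 'b::chilbert) \<Rightarrow> ('a \<Rightarrow>\<^sub>L 'b)"
  is "\<lambda>c T x. c *\<^sub>C T x"
proof -
  fix c :: complex and T :: "'a \<Rightarrow> 'b"
  assume "bounded_linear T"
  moreover have "bounded_linear (\<lambda>y :: 'b. c *\<^sub>C y)"
    by (rule bounded_linear_intro[where K = "cmod c"])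
      (auto simp: scaleC_add_right scaleR_scaleC scaleC_scaleC norm_scaleC mult.commute)
  ultimately show "bounded_linear (\<lambda>x. c *\<^sub>C T x)"
    using bounded_linear_compose by blast
qed

definition op_adj :: "('a::chilbert \<Rightarrow>\<^sub>L 'b::chilbert) \<Rightarrow> ('b \<Rightarrow>\<^sub>L 'a)" where
  "op_adj T = (THE S. \<forall>x y. cinner (blinfun_apply T x) y = cinner x (blinfun_apply S y))"

definition orth_proj :: "'a::chilbert set \<Rightarrow> 'a \<Rightarrow> 'a" where
  "orth_proj M x = (THE y. y \<in> M \<and> (\<forall>z\<in>M. cinner (x - y) z = 0))"

(* The free semigroup on n generators is the type 'n list with CARD('n) = n; the identity is []
   and the word length is length. An n-tuple of operators is a function on 'n. *)
definition word_op :: "('n \<Rightarrow> 'a::chilbert \<Rightarrow>\<^sub>L 'a) \<Rightarrow> 'n list \<Rightarrow> ('a \<Rightarrow>\<^sub>L 'a)" where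
  "word_op T \<alpha> = foldr (\<lambda>i S. T i o\<^sub>L S) \<alpha> id_blinfun"

(* The class C_rho, with the dilation space G ranging over the Hilbert spaces carried by the type
   'g. The inclusion of H in G is a linear isometry J, so that T_alpha = rho P_H V_alpha|_H reads
   J T_alpha = rho P V_alpha J with P the orthogonal projection onto the range of J. HOL cannot
   quantify existentially over types: membership in C_rho means class_C TYPE('g) for some 'g, and
   as a hypothesis of a theorem this is class_C TYPE('g) with 'g a free type variable. *)
definition class_C ::
    "'g::chilbert itself \<Rightarrow> real \<Rightarrow> ('n::finite \<Rightarrow> 'h::chilbert \<Rightarrow>\<^sub>L 'h) set" where
  "class_C _ \<rho> = {T. (\<forall>i. T i \<in> bop) \<and>
     (\<exists>(J :: 'h \<Rightarrow>\<^sub>L 'g) (V :: 'n \<Rightarrow> 'g \<Rightarrow>\<^sub>L 'g).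
        J \<in> bop \<and> (\<forall>x. norm (blinfun_apply J x) = norm x) \<and>
        (\<forall>i. V i \<in> bop \<and> (\<forall>x. norm (blinfun_apply (V i) x) = norm x)) \<and>
        (\<forall>i j x y. i \<noteq> j \<longrightarrow>
           cinner (blinfun_apply (V i) x) (blinfun_apply (V j) y) = 0) \<and>
        (\<forall>\<alpha>. \<alpha> \<noteq> [] \<longrightarrow> (\<forall>x. blinfun_apply J (blinfun_apply (word_op T \<alpha>) x) =
           \<rho> *\<^sub>R orth_proj (range (blinfun_apply J))
                  (blinfun_apply (word_op V \<alpha>) (blinfun_apply J x)))))}"

definition joint_spectral_radius :: "('n::finite \<Rightarrow> 'h::chilbert \<Rightarrow>\<^sub>L 'h) \<Rightarrow> real" where
  "joint_spectral_radius T =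
     lim (\<lambda>k. root (2 * k) (norm (\<Sum>\<alpha> | length \<alpha> = k. word_op T \<alpha> o\<^sub>L op_adj (word_op T \<alpha>))))"

definition open_row_ball :: "('n::finite \<Rightarrow> 'k::chilbert \<Rightarrow>\<^sub>L 'k) set" where
  "open_row_ball = {X. (\<forall>i. X i \<in> bop) \<and> norm (\<Sum>i\<in>UNIV. X i o\<^sub>L op_adj (X i)) < 1}"

(* Polynomials p = sum_alpha X_alpha \<otimes> M_alpha in noncommuting indeterminates indexed by 'n with
   coefficients M_alpha in M_m, as finitely supported coefficient functions. *)
definition nc_polys :: "nat \<Rightarrow> ('n list \<Rightarrow> complex mat) set" where
  "nc_polys m = {p. (\<forall>\<alpha>. p \<alpha> \<in> carrier_mat m m) \<and> finite {\<alpha>. p \<alpha> \<noteq> 0\<^sub>m m m}}"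

(* Operators on the tensor product of H with C^m are m by m matrices over B(H); the (i,j) entry
   of T \<otimes> M is M_ij T. *)
definition nc_eval ::
    "nat \<Rightarrow> ('n list \<Rightarrow> complex mat) \<Rightarrow> ('n \<Rightarrow> 'a::chilbert \<Rightarrow>\<^sub>L 'a) \<Rightarrow> ('a \<Rightarrow>\<^sub>L 'a) mat" where
  "nc_eval m p T = Matrix.mat m m (\<lambda>(i, j).
     \<Sum>\<alpha> | p \<alpha> \<noteq> 0\<^sub>m m m. scaleC_op (p \<alpha> $$ (i, j)) (word_op T \<alpha>))"

definition opmat_adj :: "('a::chilbert \<Rightarrow>\<^sub>L 'a) mat \<Rightarrow> ('a \<Rightarrow>\<^sub>L 'a) mat" where
  "opmat_adj P = map_mat op_adj (transpose_mat P)"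

definition opmat_scaleR :: "real \<Rightarrow> ('a::chilbert \<Rightarrow>\<^sub>L 'a) mat \<Rightarrow> ('a \<Rightarrow>\<^sub>L 'a) mat" where
  "opmat_scaleR r P = map_mat (\<lambda>T. r *\<^sub>R T) P"

definition opmat_Re :: "('a::chilbert \<Rightarrow>\<^sub>L 'a) mat \<Rightarrow> ('a \<Rightarrow>\<^sub>L 'a) mat" where
  "opmat_Re P = opmat_scaleR (1/2) (opmat_adj P + P)"

(* P \<ge> 0 as an operator on the m-fold direct sum of H: \<langle>P x, x\<rangle> is real and nonnegative for all
   x = (x_0, ..., x_(m-1)). *)
definition opmat_nonneg :: "('a::chilbert \<Rightarrow>\<^sub>L 'a) mat \<Rightarrow> bool" where
  "opmat_nonneg P \<longleftrightarrow> (\<forall>x :: nat \<Rightarrow> 'a.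
     (\<Sum>i<dim_row P. \<Sum>j<dim_col P. cinner (blinfun_apply (P $$ (i, j)) (x j)) (x i))
       \<in> {z. Im z = 0 \<and> 0 \<le> Re z})"

definition opmat_le :: "('a::chilbert \<Rightarrow>\<^sub>L 'a) mat \<Rightarrow> ('a \<Rightarrow>\<^sub>L 'a) mat \<Rightarrow> bool" where
  "opmat_le P Q \<longleftrightarrow> opmat_nonneg (Q - P)"

(* Harnack domination; 'k carries the space K on which the positivity of Re p is tested. The
   expression compared is Re p(T) + (rho - 1) Re p(0), 0 being the zero tuple on the space of T.
   The relation is meant for A and B in C_rho; the zero tuple always belongs to C_rho. *)
definition harnack_form ::
    "real \<Rightarrow> nat \<Rightarrow> ('n list \<Rightarrow> complex mat) \<Rightarrow> ('n \<Rightarrow> 'a::chilbert \<Rightarrow>\<^sub>L 'a) \<Rightarrow> ('a \<Rightarrow>\<^sub>L 'a) mat"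
  where
  "harnack_form \<rho> m p T =
     opmat_Re (nc_eval m p T) + opmat_scaleR (\<rho> - 1) (opmat_Re (nc_eval m p (\<lambda>_. 0)))"

definition harnack_dominated :: "'k::chilbert itself \<Rightarrow> real \<Rightarrow>
    ('n::finite \<Rightarrow> 'h::chilbert \<Rightarrow>\<^sub>L 'h) \<Rightarrow> ('n \<Rightarrow> 'h \<Rightarrow>\<^sub>L 'h) \<Rightarrow> bool" where
  "harnack_dominated _ \<rho> A B \<longleftrightarrow> (\<exists>c>0. \<forall>m. \<forall>p \<in> nc_polys m.
     (\<forall>X :: 'n \<Rightarrow> 'k \<Rightarrow>\<^sub>L 'k. X \<in> open_row_ball \<longrightarrow> opmat_nonneg (opmat_Re (nc_eval m p X))) \<longrightarrow>
     opmat_le (harnack_form \<rho> m p A) (opmat_scaleR (c\<^sup>2) (harnack_form \<rho> m p B)))"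

end

(* For an operator tuple T and vectors x_d indexed by the words d of length at most N, put
   z_d = sum_a T_a x_(da), so that z_d - x_d = sum_i T_i z_(di). The Toeplitz form
   sum_d (2 Re <z_d, x_d> - |x_d|^2) telescopes to
   |z_[]|^2 + sum_d (sum_i |z_(di)|^2 - |sum_i T_i z_(di)|^2).
   It is the form of Re p for a polynomial p whose coefficients are products of backward shift
   matrices; it is nonnegative on row contractions and equals |sum_a V_a x_a|^2 for isometries
   with orthogonal ranges. Through the dilation of A, domination by 0 therefore bounds |sum_a V_a J x_a| by c |x|. Choosing
   x_a = A_a^* y gives sum_k sum_(|a| = k) |A_a^* y|^2 <= D |y|^2, and this forces
   |sum_(|a| = k) A_a A_a^*| -> 0.

   Conversely, compressing Re p(X) for truncated creation operators X to the basis vectors of the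
   empty word and the words of length k isolates the coefficients M_a with |a| = k. Testing the
   resulting positive form with x and -s A_a^* x bounds Re <sum_(|a| = k) (A_a tensor M_a) x, x>
   by a multiple of u^k Re <M_[] x, x>, where u < 1 comes from the spectral radius; the geometric
   series gives domination. *)

theory Submission
  imports Defs
begin

text \<open>Positivity of Re p is known only on K, whereas domination is about vectors of H. The
  bridge is a Schur product: testing on orthonormal vectors of K gives a scalar kernel built from
  the coefficients of p, and pairing this kernel with a Gram matrix of vectors of H keeps it
  nonnegative. The orthonormal systems must be arbitrarily large, which is where the infinite
  dimension of K enters. In the first direction the matrix coefficients have rows and columns
  indexed by words, so that the vectors x_a can be chosen independently of each other. The diagonal
  of the Toeplitz form is 1, but the dilation carries a factor rho on every nonempty word; the
  summand (rho - 1) Re p(0) raises the diagonal to rho as well, and the form of A becomes rho times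
  that of the dilation. The spectral radius enters through submultiplicativity alone: the limit is
  an infimum, so r < 1 as soon as one row norm is below 1, and then the row norms decay
  geometrically. In the converse direction the truncated creation operators have to lie in the open
  ball, which costs a factor u^k in degree k; a decay rate u^4 of the row norms pays for it.\<close>

section \<open>Complex Hilbert spaces and adjoints\<close>

lemma scaleC_one [simp]: "1 *\<^sub>C (x::'a::chilbert) = x"
  by (metis of_real_1 scaleR_one scaleR_scaleC)

lemma scaleC_zero_left [simp]: "0 *\<^sub>C (x::'a::chilbert) = 0"
  by (metis of_real_0 scaleR_scaleC scaleR_zero_left)

lemma scaleC_zero_right [simp]: "c *\<^sub>C (0::'a::chilbert) = 0"
  by (metis scaleC_add_right add_cancel_right_right)

lemma scaleC_sum_right: "c *\<^sub>C (\<Sum>i\<in>I. f i) = (\<Sum>i\<in>I. c *\<^sub>C (f i :: 'a::chilbert))"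
  by (induction I rule: infinite_finite_induct) (auto simp: scaleC_add_right)

lemma cinner_add_right: "cinner (z::'a::chilbert) (x + y) = cinner z x + cinner z y"
  by (metis cinner_commute cinner_add_left complex_cnj_add)

lemma cinner_scaleC_right: "cinner (x::'a::chilbert) (c *\<^sub>C y) = cnj c * cinner x y"
  by (metis cinner_commute cinner_scaleC_left complex_cnj_mult)

lemma cinner_zero_left [simp]: "cinner 0 (x::'a::chilbert) = 0"
  by (metis cinner_scaleC_left mult_zero_left scaleC_zero_left)

lemma cinner_zero_right [simp]: "cinner (x::'a::chilbert) 0 = 0"
  by (metis cinner_commute cinner_zero_left complex_cnj_zero)

lemma cinner_minus_left: "cinner (- x) (y::'a::chilbert) = - cinner x y"
  by (metis add.right_inverse cinner_add_left cinner_zero_left neg_eq_iff_add_eq_0)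

lemma cinner_diff_left: "cinner (x - y) (z::'a::chilbert) = cinner x z - cinner y z"
  using cinner_add_left[of x "- y" z] by (simp add: cinner_minus_left)

lemma cinner_diff_right: "cinner z (x - y::'a::chilbert) = cinner z x - cinner z y"
  by (metis cinner_commute cinner_diff_left complex_cnj_diff)

lemma cinner_sum_left: "cinner (\<Sum>i\<in>I. f i) (y::'a::chilbert) = (\<Sum>i\<in>I. cinner (f i) y)"
  by (induction I rule: infinite_finite_induct) (auto simp: cinner_add_left)

lemma cinner_sum_right: "cinner (y::'a::chilbert) (\<Sum>i\<in>I. f i) = (\<Sum>i\<in>I. cinner y (f i))"
  by (induction I rule: infinite_finite_induct) (auto simp: cinner_add_right)

lemma Re_cinner: "Re (cinner x y) = inner x (y::'a::chilbert)"
  by (simp add: inner_eq_Re_cinner)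

lemma cinner_self: "cinner x x = complex_of_real ((norm (x::'a::chilbert))\<^sup>2)"
proof (rule complex_eqI)
  show "Im (cinner x x) = Im (complex_of_real ((norm x)\<^sup>2))"
    using arg_cong[OF cinner_commute[of x x], of Im] by simp
qed (simp add: Re_cinner power2_norm_eq_inner)

lemma cinner_ext:
  assumes "\<And>z. cinner z x = cinner z (y::'a::chilbert)"
  shows "x = y"
proof -
  have "cinner (x - y) (x - y) = 0"
    using assms by (simp add: cinner_diff_right)
  then show ?thesis
    by (simp add: cinner_self)
qed

text \<open>The representing vector minimises |x|^2 - 2 f(x). The parallelogram law makes minimising
  sequences Cauchy, and the vanishing first variation at the limit is the claim.\<close>

lemma riesz_representation:
  fixes f :: "'a::{real_inner,complete_space} \<Rightarrow> real"
  assumes f: "bounded_linear f"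
  obtains z where "\<And>x. f x = inner x z"
proof -
  interpret bounded_linear f by fact
  define g where "g x = (norm x)\<^sup>2 - 2 * f x" for x
  obtain K where K: "\<And>x. norm (f x) \<le> norm x * K"
    using bounded by blast
  have lower: "- K\<^sup>2 \<le> g x" for x
  proof -
    have "f x \<le> norm x * K"
      using K[of x] by simp
    moreover have "0 \<le> (norm x - K)\<^sup>2"
      by simp
    ultimately show ?thesis
      by (simp add: g_def power2_diff)
  qed
  have bdd: "bdd_below (range g)"
    by (rule bdd_belowI2[of _ "- K\<^sup>2"]) (rule lower)
  define d where "d = (INF x. g x)"
  have d_le: "d \<le> g x" for x
    unfolding d_def by (rule cINF_lower[OF bdd]) simp
  have "\<exists>x. g x < d + 1 / real (Suc n)" for n
  proof -
    have "d < d + 1 / real (Suc n)"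
      by simp
    then show ?thesis
      unfolding d_def by (subst (asm) cINF_less_iff) (auto simp: bdd)
  qed
  then obtain X where X: "\<And>n. g (X n) < d + 1 / real (Suc n)"
    by metis
  \<comment> \<open>The midpoint of x and y has value at least \<open>d\<close>, so two
    near-minimisers are close to each other.\<close>
  have parallelogram: "(norm (x - y))\<^sup>2 \<le> 2 * (g x - d) + 2 * (g y - d)" for x y
  proof -
    have "4 * g ((1/2) *\<^sub>R (x + y)) = (norm (x + y))\<^sup>2 - 4 * (f x + f y)"
      by (simp add: g_def add scale power_divide add_divide_distrib)
    moreover have "(norm (x + y))\<^sup>2 + (norm (x - y))\<^sup>2 = 2 * (norm x)\<^sup>2 + 2 * (norm y)\<^sup>2"
      by (simp add: power2_norm_eq_inner inner_add inner_diff inner_commute)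
    ultimately have "(norm (x - y))\<^sup>2 = 2 * g x + 2 * g y - 4 * g ((1/2) *\<^sub>R (x + y))"
      by (simp add: g_def)
    then show ?thesis
      using d_le[of "(1/2) *\<^sub>R (x + y)"] by simp
  qed
  have "Cauchy X"
  proof (rule metric_CauchyI)
    fix e :: real assume e: "0 < e"
    obtain M where M: "4 / e\<^sup>2 < real M"
      using reals_Archimedean2 by blast
    then have M0: "0 < real M"
      using e by (smt (verit) divide_nonneg_nonneg zero_le_power2)
    have small: "g (X m) - d < e\<^sup>2 / 4" if "M \<le> m" for m
    proof -
      have "1 / real (Suc m) \<le> 1 / real M"
        using that M0 by (intro divide_left_mono) auto
      also have "\<dots> < e\<^sup>2 / 4"
        using M M0 e by (simp add: field_simps)
      finally show ?thesis
        using X[of m] by simp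
    qed
    have "dist (X m) (X n) < e" if "M \<le> m" "M \<le> n" for m n
    proof -
      have "(norm (X m - X n))\<^sup>2 < e\<^sup>2"
        using parallelogram[of "X m" "X n"] small[OF that(1)] small[OF that(2)] by simp
      then show ?thesis
        using e by (simp add: dist_norm power_less_imp_less_base)
    qed
    then show "\<exists>M. \<forall>m\<ge>M. \<forall>n\<ge>M. dist (X m) (X n) < e"
      by blast
  qed
  then obtain z where z: "X \<longlonglongrightarrow> z"
    using Cauchy_convergent convergent_def by blast
  have "(\<lambda>n. g (X n)) \<longlonglongrightarrow> g z"
    unfolding g_def by (intro tendsto_intros z tendsto[OF z])
  moreover have "(\<lambda>n. d + 1 / real (Suc n)) \<longlonglongrightarrow> d + 0"
    by (intro tendsto_intros LIMSEQ_Suc lim_1_over_n)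
  ultimately have "g z \<le> d"
    by (metis (no_types, lifting) LIMSEQ_le X add.right_neutral less_imp_le)
  have "f x = inner x z" for x
  proof -
    define b where "b = inner x z - f x"
    have quad: "0 \<le> 2 * t * b + t\<^sup>2 * (norm x)\<^sup>2" for t
    proof -
      have "g (z + t *\<^sub>R x) = g z + 2 * t * b + t\<^sup>2 * (norm x)\<^sup>2"
        by (simp add: g_def b_def add scale power2_norm_eq_inner inner_add_left inner_add_right
            inner_commute[of x z] algebra_simps) (simp add: power2_eq_square)
      then show ?thesis
        using d_le[of "z + t *\<^sub>R x"] \<open>g z \<le> d\<close> by simp
    qed
    \<comment> \<open>The summand 1 keeps the divisor positive when x = 0; t = - b / c in
      \<open>quad\<close> then forces b = 0.\<close>
    define c where "c = (norm x)\<^sup>2 + 1"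
    have c: "c > 0" "(norm x)\<^sup>2 \<le> c"
      by (auto simp: c_def intro: add_nonneg_pos)
    have "2 * (b / c) * b \<le> (b / c)\<^sup>2 * (norm x)\<^sup>2"
      using quad[of "- b / c"] by simp
    also have "\<dots> \<le> (b / c)\<^sup>2 * c"
      using c by (intro mult_left_mono) auto
    finally have "b\<^sup>2 \<le> 0"
      using c by (simp add: field_simps power2_eq_square)
    then show ?thesis
      by (simp add: b_def)
  qed
  then show thesis
    by (rule that)
qed

lemma bop_scaleC: "T \<in> bop \<Longrightarrow> blinfun_apply T (c *\<^sub>C x) = c *\<^sub>C blinfun_apply T x"
  by (simp add: bop_def)

text \<open>The Riesz theorem for the real inner product gives the real part of the identity. Its
  imaginary part is the real part at \<i> x, by complex linearity of T.\<close>

lemma op_adj_exists: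
  fixes T :: "'a::chilbert \<Rightarrow>\<^sub>L 'b::chilbert"
  assumes T: "T \<in> bop"
  shows "\<exists>S. \<forall>x y. cinner (blinfun_apply T x) y = cinner x (blinfun_apply S y)"
proof -
  have "\<exists>z. \<forall>x. inner (blinfun_apply T x) y = inner x z" for y
  proof -
    have "bounded_linear (\<lambda>x. inner (blinfun_apply T x) y)"
      by (intro bounded_linear_intros)
    then show ?thesis
      by (rule riesz_representation) blast
  qed
  then obtain s where s: "\<And>x y. inner (blinfun_apply T x) y = inner x (s y)"
    by (metis (full_types))
  have adj: "cinner (blinfun_apply T x) y = cinner x (s y)" for x y
  proof (rule complex_eqI)
    show "Re (cinner (blinfun_apply T x) y) = Re (cinner x (s y))"
      by (simp add: Re_cinner s)
    have "inner (blinfun_apply T (\<i> *\<^sub>C x)) y = inner (\<i> *\<^sub>C x) (s y)"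
      by (rule s)
    then show "Im (cinner (blinfun_apply T x) y) = Im (cinner x (s y))"
      by (simp add: Re_cinner[symmetric] bop_scaleC[OF T] cinner_scaleC_left)
  qed
  have "bounded_linear s"
  proof (rule bounded_linear_intro)
    show "s (x + y) = s x + s y" for x y
      by (rule cinner_ext) (simp add: adj[symmetric] cinner_add_right)
    show "s (r *\<^sub>R x) = r *\<^sub>R s x" for r x
      by (rule cinner_ext) (simp add: scaleR_scaleC adj[symmetric] cinner_scaleC_right)
    show "norm (s y) \<le> norm y * norm T" for y
    proof -
      have "(norm (s y))\<^sup>2 = inner (blinfun_apply T (s y)) y"
        by (simp add: power2_norm_eq_inner s)
      also have "\<dots> \<le> norm (blinfun_apply T (s y)) * norm y"
        by (rule norm_cauchy_schwarz)
      also have "\<dots> \<le> norm T * norm (s y) * norm y"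
        by (intro mult_right_mono norm_blinfun norm_ge_zero)
      finally show ?thesis
        by (cases "norm (s y) = 0") (simp_all add: power2_eq_square mult.commute mult.left_commute)
    qed
  qed
  from bounded_linear_Blinfun_apply[OF this] show ?thesis
    by (intro exI[of _ "Blinfun s"]) (simp only: adj simp_thms)
qed

lemma op_adj_eqI:
  assumes "\<And>x y. cinner (blinfun_apply T x) y = cinner x (blinfun_apply S y)"
  shows "op_adj T = S"
  unfolding op_adj_def
proof (rule the_equality)
  fix S' assume "\<forall>x y. cinner (blinfun_apply T x) y = cinner x (blinfun_apply S' y)"
  then show "S' = S"
    by (intro blinfun_eqI cinner_ext) (simp add: assms[symmetric])
qed (simp add: assms)

lemma op_adj:
  assumes "T \<in> bop"
  shows "cinner (blinfun_apply T x) y = cinner x (blinfun_apply (op_adj T) y)"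
proof -
  obtain S where "\<forall>x y. cinner (blinfun_apply T x) y = cinner x (blinfun_apply S y)"
    using op_adj_exists[OF assms] by blast
  then show ?thesis
    by (subst op_adj_eqI[of T S]) auto
qed

lemma inner_op_adj:
  assumes "T \<in> bop"
  shows "inner (blinfun_apply T x) y = inner x (blinfun_apply (op_adj T) y)"
  by (simp only: Re_cinner[symmetric] op_adj[OF assms])

lemma op_adj_compose:
  assumes "S \<in> bop" "T \<in> bop"
  shows "op_adj (S o\<^sub>L T) = op_adj T o\<^sub>L op_adj S"
  by (rule op_adj_eqI) (simp add: op_adj assms)

lemma op_adj_in_bop:
  assumes "T \<in> bop"
  shows "op_adj T \<in> bop"
proof -
  have "blinfun_apply (op_adj T) (c *\<^sub>C x) = c *\<^sub>C blinfun_apply (op_adj T) x" for c x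
    by (rule cinner_ext) (simp only: op_adj[OF assms, symmetric] cinner_scaleC_right)
  then show ?thesis
    by (simp add: bop_def)
qed

text \<open>For an isometry J the adjoint is a left inverse, so J followed after J^* is the
  orthogonal projection onto the range.\<close>

lemma orth_proj_range:
  assumes J: "J \<in> bop" and iso: "\<And>x. norm (blinfun_apply J x) = norm x"
  shows "orth_proj (range (blinfun_apply J)) y = blinfun_apply J (blinfun_apply (op_adj J) y)"
    and "blinfun_apply (op_adj J) (blinfun_apply J x) = x"
proof -
  \<comment> \<open>Polarisation: preserving norms implies preserving inner products.\<close>
  have inn: "inner (blinfun_apply J u) (blinfun_apply J v) = inner u v" for u v
  proof -
    have "(norm (blinfun_apply J (u + v)))\<^sup>2 = (norm (u + v))\<^sup>2"
      by (simp only: iso)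
    then show ?thesis
      by (simp only: dot_norm[of "blinfun_apply J u"] dot_norm[of u] iso blinfun.add_right[symmetric])
  qed
  have JJ: "blinfun_apply (op_adj J) (blinfun_apply J x) = x" for x
  proof -
    have "inner u (blinfun_apply (op_adj J) (blinfun_apply J x) - x) = 0" for u
      by (simp add: inner_diff_right inner_op_adj[OF J, symmetric] inn)
    from this[of "blinfun_apply (op_adj J) (blinfun_apply J x) - x"] show ?thesis
      by simp
  qed
  then show "blinfun_apply (op_adj J) (blinfun_apply J x) = x" .
  show "orth_proj (range (blinfun_apply J)) y = blinfun_apply J (blinfun_apply (op_adj J) y)"
    unfolding orth_proj_def
  proof (rule the_equality)
    have "cinner (y - blinfun_apply J (blinfun_apply (op_adj J) y)) (blinfun_apply J z) = 0" for z
    proof -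
      have "cinner (blinfun_apply J z) (y - blinfun_apply J (blinfun_apply (op_adj J) y)) = 0"
        by (simp add: op_adj[OF J] blinfun.diff_right JJ)
      then show ?thesis
        by (subst cinner_commute) simp
    qed
    then show "blinfun_apply J (blinfun_apply (op_adj J) y) \<in> range (blinfun_apply J) \<and>
      (\<forall>z\<in>range (blinfun_apply J). cinner (y - blinfun_apply J (blinfun_apply (op_adj J) y)) z = 0)"
      by blast
  next
    fix w assume w: "w \<in> range (blinfun_apply J) \<and>
      (\<forall>z\<in>range (blinfun_apply J). cinner (y - w) z = 0)"
    then obtain v where v: "w = blinfun_apply J v"
      by blast
    have "cinner u (blinfun_apply (op_adj J) (y - w)) = 0" for u
    proof -
      have "cinner (blinfun_apply J u) (y - w) = 0"
        using w by (subst cinner_commute) simp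
      then show ?thesis
        by (simp add: op_adj[OF J])
    qed
    then have "blinfun_apply (op_adj J) (y - w) = 0"
      by (intro cinner_ext) simp
    then have "v = blinfun_apply (op_adj J) y"
      by (simp add: v blinfun.diff_right JJ)
    then show "w = blinfun_apply J (blinfun_apply (op_adj J) y)"
      by (simp add: v)
  qed
qed

section \<open>Row norms and the joint spectral radius\<close>

text \<open>Splitting k into blocks of length m costs at most b^m per block; the constant absorbs
  the remainders s < m. The summand 1 in \<open>C\<close> makes it positive even if all these terms
  vanish.\<close>

lemma submult_exp_bound:
  fixes a :: "nat \<Rightarrow> real"
  assumes nonneg: "\<And>k. 0 \<le> a k" and submult: "\<And>k l. a (k + l) \<le> a k * a l"
    and b: "0 < b" "a m \<le> b ^ m" and m: "1 \<le> m"
  shows "\<exists>C>0. \<forall>k. a k \<le> C * b ^ k"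
proof -
  define C where "C = (\<Sum>s<m. a s / b ^ s) + 1"
  have "0 \<le> (\<Sum>s<m. a s / b ^ s)"
    using b nonneg by (intro sum_nonneg) simp
  then have C: "0 < C"
    by (simp add: C_def)
  have "a k \<le> C * b ^ k" for k
  proof (induction k rule: less_induct)
    case (less k)
    show ?case
    proof (cases "k < m")
      case True
      then have "a k / b ^ k \<le> (\<Sum>s<m. a s / b ^ s)"
        using b nonneg by (intro member_le_sum) auto
      then have "a k / b ^ k \<le> C"
        by (simp add: C_def)
      then show ?thesis
        using b by (simp add: divide_le_eq)
    next
      case False
      have "a k \<le> a m * a (k - m)"
        using submult[of m "k - m"] False by simp
      also have "\<dots> \<le> b ^ m * (C * b ^ (k - m))"
        using less.IH[of "k - m"] False m b nonneg by (intro mult_mono) auto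
      also have "\<dots> = C * b ^ k"
        using False by (simp add: power_add[symmetric] mult.left_commute)
      finally show ?thesis .
    qed
  qed
  with C show ?thesis
    by blast
qed

text \<open>Fekete's lemma in multiplicative form. If some root lies below b, then a k <= C b^k, and
  the k-th root of C tends to 1. The infimum starts at 1 because \<open>root 0\<close> is constantly
  0.\<close>

lemma fekete_root:
  fixes a :: "nat \<Rightarrow> real"
  assumes nonneg: "\<And>k. 0 \<le> a k" and submult: "\<And>k l. a (k + l) \<le> a k * a l"
  defines "L \<equiv> INF m\<in>{1..}. root m (a m)"
  shows "(\<lambda>k. root k (a k)) \<longlonglongrightarrow> L" and "1 \<le> m \<Longrightarrow> L \<le> root m (a m)"
proof -
  have bdd: "bdd_below ((\<lambda>m. root m (a m)) ` {1..})"
    by (rule bdd_belowI2[of _ 0]) (simp add: nonneg)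
  show le: "L \<le> root m (a m)" if "1 \<le> m" for m
    unfolding L_def using that by (intro cINF_lower bdd) simp
  show "(\<lambda>k. root k (a k)) \<longlonglongrightarrow> L"
  proof (rule order_tendstoI)
    fix y assume "y < L"
    then show "\<forall>\<^sub>F k in sequentially. y < root k (a k)"
      unfolding eventually_sequentially using le less_le_trans by blast
  next
    fix y assume "L < y"
    then obtain m where m: "1 \<le> m" "root m (a m) < y"
      unfolding L_def by (subst (asm) cINF_less_iff[OF _ bdd]) auto
    then obtain b where b: "root m (a m) < b" "b < y"
      using dense by blast
    have "0 \<le> root m (a m)"
      by (intro real_root_ge_zero nonneg)
    with b have b0: "0 < b"
      by linarith
    have "a m = root m (a m) ^ m"
      using m nonneg by simp
    also have "\<dots> \<le> b ^ m"
      using b by (intro power_mono real_root_ge_zero nonneg) auto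
    finally obtain C where C: "C > 0" "\<And>k. a k \<le> C * b ^ k"
      using submult_exp_bound[OF nonneg submult b0 _ m(1)] by blast
    have "(\<lambda>k. root k C * b) \<longlonglongrightarrow> 1 * b"
      by (intro tendsto_intros LIMSEQ_root_const C)
    then have ev: "\<forall>\<^sub>F k in sequentially. root k C * b < y"
      using b by (intro order_tendstoD) auto
    have bound: "root k (a k) \<le> root k C * b" if "1 \<le> k" for k
    proof -
      have "root k (a k) \<le> root k (C * b ^ k)"
        using that C by simp
      also have "\<dots> = root k C * b"
        using that b0 by (simp add: real_root_mult real_root_power_cancel)
      finally show ?thesis .
    qed
    show "\<forall>\<^sub>F k in sequentially. root k (a k) < y"
      using ev eventually_ge_at_top[of "1::nat"]
      by eventually_elim (use bound le_less_trans in blast)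
  qed
qed

section \<open>Words of operators and norms of rows of operators\<close>

lemma bop_id: "id_blinfun \<in> bop"
  by (simp add: bop_def)

lemma bop_zero: "0 \<in> bop"
  by (simp add: bop_def)

lemma bop_compose: "S \<in> bop \<Longrightarrow> T \<in> bop \<Longrightarrow> S o\<^sub>L T \<in> bop"
  by (simp add: bop_def)

lemma blinfun_apply_sum: "blinfun_apply (\<Sum>i\<in>I. f i) x = (\<Sum>i\<in>I. blinfun_apply (f i) x)"
  by (induction I rule: infinite_finite_induct) (auto simp: blinfun.add_left)

lemma word_op_Nil [simp]: "word_op T [] = id_blinfun"
  by (simp add: word_op_def)

lemma word_op_Cons [simp]: "word_op T (i # \<alpha>) = T i o\<^sub>L word_op T \<alpha>"
  by (simp add: word_op_def)

lemma word_op_append: "word_op T (\<alpha> @ \<beta>) = word_op T \<alpha> o\<^sub>L word_op T \<beta>"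
  by (induction \<alpha>) (auto intro!: blinfun_eqI)

lemma word_op_bop: "(\<And>i. T i \<in> bop) \<Longrightarrow> word_op T \<alpha> \<in> bop"
  by (induction \<alpha>) (auto simp: bop_id intro: bop_compose)

lemma word_op_zero: "word_op (\<lambda>_. 0) \<alpha> = (if \<alpha> = [] then id_blinfun else 0)"
  by (cases \<alpha>) (auto intro: blinfun_eqI)

lemma inner_row_op:
  assumes "\<And>i. i \<in> I \<Longrightarrow> B i \<in> bop"
  shows "inner (blinfun_apply (\<Sum>i\<in>I. B i o\<^sub>L op_adj (B i)) x) y =
    (\<Sum>i\<in>I. inner (blinfun_apply (op_adj (B i)) x) (blinfun_apply (op_adj (B i)) y))"
  using assms by (simp add: blinfun_apply_sum inner_sum_left inner_op_adj)

lemma row_op_le_norm: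
  fixes B :: "'i \<Rightarrow> 'a::chilbert \<Rightarrow>\<^sub>L 'a"
  assumes "\<And>i. i \<in> I \<Longrightarrow> B i \<in> bop"
  shows "(\<Sum>i\<in>I. (norm (blinfun_apply (op_adj (B i)) y))\<^sup>2)
    \<le> norm (\<Sum>i\<in>I. B i o\<^sub>L op_adj (B i)) * (norm y)\<^sup>2"
proof -
  let ?R = "\<Sum>i\<in>I. B i o\<^sub>L op_adj (B i)"
  have "(\<Sum>i\<in>I. (norm (blinfun_apply (op_adj (B i)) y))\<^sup>2) = inner (blinfun_apply ?R y) y"
    using inner_row_op[where I = I and B = B and x = y and y = y] assms by (simp add: power2_norm_eq_inner)
  also have "\<dots> \<le> norm (blinfun_apply ?R y) * norm y"
    by (rule norm_cauchy_schwarz)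
  also have "\<dots> \<le> norm ?R * norm y * norm y"
    by (intro mult_right_mono norm_blinfun norm_ge_zero)
  finally show ?thesis
    by (simp add: power2_eq_square mult.assoc)
qed

lemma sum_inner_le:
  fixes u v :: "'i \<Rightarrow> 'a::real_inner"
  shows "(\<Sum>i\<in>I. inner (u i) (v i)) \<le> sqrt (\<Sum>i\<in>I. (norm (u i))\<^sup>2) * sqrt (\<Sum>i\<in>I. (norm (v i))\<^sup>2)"
proof -
  have "(\<Sum>i\<in>I. inner (u i) (v i)) \<le> (\<Sum>i\<in>I. \<bar>norm (u i)\<bar> * \<bar>norm (v i)\<bar>)"
    by (intro sum_mono) (simp add: norm_cauchy_schwarz)
  also have "\<dots> \<le> L2_set (\<lambda>i. norm (u i)) I * L2_set (\<lambda>i. norm (v i)) I"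
    by (rule L2_set_mult_ineq)
  finally show ?thesis
    by (simp add: L2_set_def)
qed

text \<open>Converse of \<open>row_op_le_norm\<close>: together they identify the norm with the best
  constant in the quadratic bound. For z = R y, with R the row operator, Cauchy-Schwarz in the
  direct sum gives |z|^2 <= c |y| |z|.\<close>

lemma norm_row_op_le:
  fixes B :: "'i \<Rightarrow> 'a::chilbert \<Rightarrow>\<^sub>L 'a"
  assumes B: "\<And>i. i \<in> I \<Longrightarrow> B i \<in> bop" and c: "0 \<le> c"
    and le: "\<And>y. (\<Sum>i\<in>I. (norm (blinfun_apply (op_adj (B i)) y))\<^sup>2) \<le> c * (norm y)\<^sup>2"
  shows "norm (\<Sum>i\<in>I. B i o\<^sub>L op_adj (B i)) \<le> c"
proof (rule norm_blinfun_bound[OF c])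
  fix y
  let ?z = "blinfun_apply (\<Sum>i\<in>I. B i o\<^sub>L op_adj (B i)) y"
  have "(norm ?z)\<^sup>2 =
    (\<Sum>i\<in>I. inner (blinfun_apply (op_adj (B i)) y) (blinfun_apply (op_adj (B i)) ?z))"
    using inner_row_op[where I = I and B = B and x = y and y = ?z] B by (simp add: power2_norm_eq_inner)
  also have "\<dots> \<le> sqrt (\<Sum>i\<in>I. (norm (blinfun_apply (op_adj (B i)) y))\<^sup>2)
      * sqrt (\<Sum>i\<in>I. (norm (blinfun_apply (op_adj (B i)) ?z))\<^sup>2)"
    by (rule sum_inner_le)
  also have "\<dots> \<le> sqrt (c * (norm y)\<^sup>2) * sqrt (c * (norm ?z)\<^sup>2)"
    using c by (intro mult_mono real_sqrt_le_mono le) (auto intro!: sum_nonneg)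
  also have "\<dots> = c * norm y * norm ?z"
    using c by (simp add: real_sqrt_mult)
  finally show "norm ?z \<le> c * norm y"
    by (cases "norm ?z = 0") (use c in \<open>auto simp: power2_eq_square\<close>)
qed

text \<open>A row of operators is contractive because its adjoint, the column of the adjoints,
  is.\<close>

lemma norm_row_sum_le:
  fixes X :: "'i \<Rightarrow> 'a::chilbert \<Rightarrow>\<^sub>L 'a"
  assumes X: "\<And>i. i \<in> I \<Longrightarrow> X i \<in> bop"
    and le: "norm (\<Sum>i\<in>I. X i o\<^sub>L op_adj (X i)) \<le> 1"
  shows "(norm (\<Sum>i\<in>I. blinfun_apply (X i) (z i)))\<^sup>2 \<le> (\<Sum>i\<in>I. (norm (z i))\<^sup>2)"
proof -
  let ?w = "\<Sum>i\<in>I. blinfun_apply (X i) (z i)"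
  let ?s = "\<Sum>i\<in>I. (norm (z i))\<^sup>2"
  have s: "0 \<le> ?s"
    by (simp add: sum_nonneg)
  have "(norm ?w)\<^sup>2 = (\<Sum>i\<in>I. inner (blinfun_apply (X i) (z i)) ?w)"
    by (simp add: power2_norm_eq_inner inner_sum_left)
  also have "\<dots> = (\<Sum>i\<in>I. inner (z i) (blinfun_apply (op_adj (X i)) ?w))"
    by (intro sum.cong refl inner_op_adj X)
  also have "\<dots> \<le> sqrt ?s * sqrt (\<Sum>i\<in>I. (norm (blinfun_apply (op_adj (X i)) ?w))\<^sup>2)"
    by (rule sum_inner_le)
  also have "\<dots> \<le> sqrt ?s * sqrt ((norm ?w)\<^sup>2)"
  proof (intro mult_left_mono real_sqrt_le_mono)
    have "norm (\<Sum>i\<in>I. X i o\<^sub>L op_adj (X i)) * (norm ?w)\<^sup>2 \<le> 1 * (norm ?w)\<^sup>2"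
      by (intro mult_right_mono le) simp
    then show "(\<Sum>i\<in>I. (norm (blinfun_apply (op_adj (X i)) ?w))\<^sup>2) \<le> (norm ?w)\<^sup>2"
      using row_op_le_norm[where I = I and B = X and y = ?w] X by simp
  qed (simp add: s)
  finally have "norm ?w \<le> sqrt ?s"
    by (cases "norm ?w = 0") (use s in \<open>auto simp: power2_eq_square\<close>)
  then have "(norm ?w)\<^sup>2 \<le> (sqrt ?s)\<^sup>2"
    by (intro power_mono) auto
  then show ?thesis
    using s by simp
qed

definition row_norm :: "('n::finite \<Rightarrow> 'a::chilbert \<Rightarrow>\<^sub>L 'a) \<Rightarrow> nat \<Rightarrow> real" where
  "row_norm T k = norm (\<Sum>\<alpha> | length \<alpha> = k. word_op T \<alpha> o\<^sub>L op_adj (word_op T \<alpha>))"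

text \<open>The quadratic form of the positive operator whose norm is \<open>row_norm\<close>. Being
  additive over words, it is easier to iterate than the norm.\<close>

definition row_sum :: "('n::finite \<Rightarrow> 'a::chilbert \<Rightarrow>\<^sub>L 'a) \<Rightarrow> nat \<Rightarrow> 'a \<Rightarrow> real" where
  "row_sum T k y = (\<Sum>\<alpha> | length \<alpha> = k. (norm (blinfun_apply (op_adj (word_op T \<alpha>)) y))\<^sup>2)"

lemma finite_words_eq: "finite {\<alpha> :: 'n::finite list. length \<alpha> = k}"
  using finite_lists_length_eq[of "UNIV :: 'n set" k] by simp

lemma finite_words_le: "finite {\<alpha> :: 'n::finite list. length \<alpha> \<le> k}"
  using finite_lists_length_le[of "UNIV :: 'n set" k] by simp

lemma sum_words_append:
  fixes f :: "'n::finite list \<Rightarrow> 'b::comm_monoid_add"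
  shows "(\<Sum>\<gamma> | length \<gamma> = k + l. f \<gamma>) = (\<Sum>\<alpha> | length \<alpha> = k. \<Sum>\<beta> | length \<beta> = l. f (\<alpha> @ \<beta>))"
proof -
  have "(\<Sum>\<gamma> | length \<gamma> = k + l. f \<gamma>) =
    (\<Sum>(\<alpha>, \<beta>)\<in>{\<alpha>. length \<alpha> = k} \<times> {\<beta>. length \<beta> = l}. f (\<alpha> @ \<beta>))"
    by (rule sum.reindex_bij_witness
        [where i = "\<lambda>(\<alpha>, \<beta>). \<alpha> @ \<beta>" and j = "\<lambda>\<gamma>. (take k \<gamma>, drop k \<gamma>)"]) auto
  then show ?thesis
    by (simp add: sum.cartesian_product)
qed

context
  fixes T :: "'n::finite \<Rightarrow> 'a::chilbert \<Rightarrow>\<^sub>L 'a"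
  assumes T: "\<And>i. T i \<in> bop"
begin

lemma row_sum_add:
  "row_sum T (k + l) y =
    (\<Sum>\<alpha> | length \<alpha> = k. row_sum T l (blinfun_apply (op_adj (word_op T \<alpha>)) y))"
  by (simp add: row_sum_def sum_words_append word_op_append op_adj_compose word_op_bop T)

lemma row_sum_le: "row_sum T k y \<le> row_norm T k * (norm y)\<^sup>2"
  unfolding row_sum_def row_norm_def by (rule row_op_le_norm) (simp add: word_op_bop T)

lemma row_norm_le:
  assumes "0 \<le> c" "\<And>y. row_sum T k y \<le> c * (norm y)\<^sup>2"
  shows "row_norm T k \<le> c"
  unfolding row_norm_def
  by (rule norm_row_op_le) (use assms in \<open>simp_all add: word_op_bop T row_sum_def\<close>)

lemma row_norm_nonneg: "0 \<le> row_norm T k"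
  by (simp add: row_norm_def)

lemma row_norm_add: "row_norm T (k + l) \<le> row_norm T k * row_norm T l"
proof (rule row_norm_le)
  fix y
  have "row_sum T (k + l) y \<le>
    (\<Sum>\<alpha> | length \<alpha> = k. row_norm T l * (norm (blinfun_apply (op_adj (word_op T \<alpha>)) y))\<^sup>2)"
    unfolding row_sum_add by (intro sum_mono row_sum_le)
  also have "\<dots> = row_norm T l * row_sum T k y"
    by (simp add: row_sum_def sum_distrib_left)
  also have "\<dots> \<le> row_norm T l * (row_norm T k * (norm y)\<^sup>2)"
    by (intro mult_left_mono row_sum_le row_norm_nonneg)
  finally show "row_sum T (k + l) y \<le> row_norm T k * row_norm T l * (norm y)\<^sup>2"
    by (simp add: mult_ac)
qed (simp add: row_norm_nonneg)

text \<open>By Fekete's lemma the radius is the square root of an infimum over m >= 1, so it lies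
  below 1 exactly when a single term does.\<close>

lemma joint_spectral_radius_less_one_iff:
  "joint_spectral_radius T < 1 \<longleftrightarrow> (\<exists>m\<ge>1. row_norm T m < 1)"
proof -
  define L where "L = (INF m\<in>{1..}. root m (row_norm T m))"
  note lim = fekete_root(1)[of "row_norm T", OF row_norm_nonneg row_norm_add, folded L_def]
  note le = fekete_root(2)[of "row_norm T", OF row_norm_nonneg row_norm_add, folded L_def]
  have "(\<lambda>k. root (2 * k) (row_norm T k)) = (\<lambda>k. sqrt (root k (row_norm T k)))"
    by (auto simp: sqrt_def real_root_mult_exp)
  then have "(\<lambda>k. root (2 * k) (row_norm T k)) \<longlonglongrightarrow> sqrt L"
    using tendsto_real_sqrt[OF lim] by simp
  then have jsr: "joint_spectral_radius T = sqrt L"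
    unfolding joint_spectral_radius_def row_norm_def[symmetric] by (rule limI)
  have "L < 1 \<longleftrightarrow> (\<exists>m\<ge>1. row_norm T m < 1)"
  proof
    assume "L < 1"
    then obtain N where N: "\<And>k. N \<le> k \<Longrightarrow> root k (row_norm T k) < 1"
      using order_tendstoD(2)[OF lim, of 1] unfolding eventually_sequentially by blast
    have "root (Suc N) (row_norm T (Suc N)) < 1"
      by (rule N) simp
    then have "row_norm T (Suc N) < 1"
      by simp
    then show "\<exists>m\<ge>1. row_norm T m < 1"
      by (intro exI[of _ "Suc N"]) simp
  next
    assume "\<exists>m\<ge>1. row_norm T m < 1"
    then obtain m where m: "1 \<le> m" "row_norm T m < 1"
      by blast
    then have "root m (row_norm T m) < 1"
      by simp
    with le[OF m(1)] show "L < 1"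
      by simp
  qed
  then show ?thesis
    by (simp add: jsr)
qed

lemma row_norm_exp_bound:
  assumes "joint_spectral_radius T < 1"
  obtains C t where "0 < C" "0 < t" "t < 1" "\<And>k. row_norm T k \<le> C * t ^ k"
proof -
  obtain m where m: "1 \<le> m" "row_norm T m < 1"
    using assms joint_spectral_radius_less_one_iff by blast
  then have "root m (row_norm T m) < 1"
    by simp
  \<comment> \<open>The root may be 0; a strictly larger t is positive and so serves as the base of
    the exponential bound.\<close>
  then obtain t where t: "root m (row_norm T m) < t" "t < 1"
    using dense by blast
  have "0 \<le> root m (row_norm T m)"
    by (intro real_root_ge_zero row_norm_nonneg)
  with t have t0: "0 < t"
    by linarith
  have "row_norm T m = root m (row_norm T m) ^ m"
    using m row_norm_nonneg by simp
  also have "\<dots> \<le> t ^ m"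
    using t by (intro power_mono real_root_ge_zero row_norm_nonneg) auto
  finally show thesis
    using submult_exp_bound[of "row_norm T", OF row_norm_nonneg row_norm_add t0 _ m(1)] that t t0
    by blast
qed

end

section \<open>Quadratic forms of operator polynomials\<close>

definition opmat_form :: "('a::chilbert \<Rightarrow>\<^sub>L 'a) mat \<Rightarrow> (nat \<Rightarrow> 'a) \<Rightarrow> complex" where
  "opmat_form P x =
     (\<Sum>i<dim_row P. \<Sum>j<dim_col P. cinner (blinfun_apply (P $$ (i, j)) (x j)) (x i))"

lemma opmat_nonneg_iff: "opmat_nonneg P \<longleftrightarrow> (\<forall>x. Im (opmat_form P x) = 0 \<and> 0 \<le> Re (opmat_form P x))"
  by (simp add: opmat_nonneg_def opmat_form_def)

lemma opmat_form_add:
  assumes "P \<in> carrier_mat m m" "Q \<in> carrier_mat m m"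
  shows "opmat_form (P + Q) x = opmat_form P x + opmat_form Q x"
  using assms by (simp add: opmat_form_def blinfun.add_left cinner_add_left sum.distrib)

lemma opmat_form_minus:
  assumes "P \<in> carrier_mat m m" "Q \<in> carrier_mat m m"
  shows "opmat_form (P - Q) x = opmat_form P x - opmat_form Q x"
  using assms by (simp add: opmat_form_def blinfun.diff_left cinner_diff_left sum_subtractf)

lemma opmat_form_scaleR: "opmat_form (opmat_scaleR r P) x = complex_of_real r * opmat_form P x"
  by (simp add: opmat_form_def opmat_scaleR_def blinfun.scaleR_left scaleR_scaleC
      cinner_scaleC_left sum_distrib_left)

lemma opmat_form_Re:
  assumes P: "P \<in> carrier_mat m m" and bop: "\<And>i j. i < m \<Longrightarrow> j < m \<Longrightarrow> P $$ (i, j) \<in> bop"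
  shows "opmat_form (opmat_Re P) x = complex_of_real (Re (opmat_form P x))"
proof -
  let ?c = "\<lambda>i j. cinner (blinfun_apply (P $$ (i, j)) (x j)) (x i)"
  have adj: "cinner (blinfun_apply (op_adj (P $$ (j, i))) (x j)) (x i) = cnj (?c j i)"
    if "i < m" "j < m" for i j
    using op_adj[OF bop[OF that(2,1)], of "x i" "x j"] by (metis cinner_commute)
  have "opmat_form (opmat_adj P) x = (\<Sum>i<m. \<Sum>j<m. cnj (?c j i))"
    using P by (simp add: opmat_form_def opmat_adj_def adj)
  also have "\<dots> = cnj (\<Sum>j<m. \<Sum>i<m. ?c j i)"
    by (subst sum.swap) simp
  also have "\<dots> = cnj (opmat_form P x)"
    using P by (simp add: opmat_form_def)
  finally have "opmat_form (opmat_Re P) x = (1/2) * (cnj (opmat_form P x) + opmat_form P x)"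
    unfolding opmat_Re_def opmat_form_scaleR
    by (subst opmat_form_add[of _ m]) (use P in \<open>auto simp: opmat_adj_def\<close>)
  then show ?thesis
    by (simp add: complex_eq_iff)
qed

text \<open>The quadratic form of \<open>nc_eval m p T\<close> (see
  \<open>opmat_form_nc_eval\<close>), written as a plain sum so that operator matrices disappear
  from the later arguments.\<close>

definition poly_form ::
    "nat \<Rightarrow> ('n list \<Rightarrow> complex mat) \<Rightarrow> ('n \<Rightarrow> 'a::chilbert \<Rightarrow>\<^sub>L 'a) \<Rightarrow> (nat \<Rightarrow> 'a) \<Rightarrow> complex" where
  "poly_form m p T x = (\<Sum>\<alpha> | p \<alpha> \<noteq> 0\<^sub>m m m. \<Sum>i<m. \<Sum>j<m.
     p \<alpha> $$ (i, j) * cinner (blinfun_apply (word_op T \<alpha>) (x j)) (x i))"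

lemma poly_form_superset:
  assumes "finite F" "{\<alpha>. p \<alpha> \<noteq> 0\<^sub>m m m} \<subseteq> F"
  shows "poly_form m p T x = (\<Sum>\<alpha>\<in>F. \<Sum>i<m. \<Sum>j<m.
     p \<alpha> $$ (i, j) * cinner (blinfun_apply (word_op T \<alpha>) (x j)) (x i))"
  unfolding poly_form_def
proof (rule sum.mono_neutral_left[OF assms])
  show "\<forall>\<alpha>\<in>F - {\<alpha>. p \<alpha> \<noteq> 0\<^sub>m m m}. (\<Sum>i<m. \<Sum>j<m.
     p \<alpha> $$ (i, j) * cinner (blinfun_apply (word_op T \<alpha>) (x j)) (x i)) = 0"
    by (auto intro!: sum.neutral)
qed

lemma poly_form_zero:
  assumes "p \<in> nc_polys m"
  shows "poly_form m p (\<lambda>_. 0) x = (\<Sum>i<m. \<Sum>j<m. p [] $$ (i, j) * cinner (x j) (x i))"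
proof -
  let ?F = "insert [] {\<alpha>. p \<alpha> \<noteq> 0\<^sub>m m m}"
  have fin: "finite ?F"
    using assms by (simp add: nc_polys_def)
  have "poly_form m p (\<lambda>_. 0) x = (\<Sum>\<alpha>\<in>?F. \<Sum>i<m. \<Sum>j<m.
     p \<alpha> $$ (i, j) * cinner (blinfun_apply (word_op (\<lambda>_. 0) \<alpha>) (x j)) (x i))"
    by (rule poly_form_superset[OF fin]) auto
  also have "\<dots> = (\<Sum>\<alpha>\<in>?F. if \<alpha> = [] then \<Sum>i<m. \<Sum>j<m. p [] $$ (i, j) * cinner (x j) (x i) else 0)"
    by (rule sum.cong) (auto simp: word_op_zero)
  also have "\<dots> = (\<Sum>i<m. \<Sum>j<m. p [] $$ (i, j) * cinner (x j) (x i))"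
    by (subst sum.delta[OF fin]) simp
  finally show ?thesis .
qed

lemma bop_sum: "(\<And>i. i \<in> I \<Longrightarrow> f i \<in> bop) \<Longrightarrow> (\<Sum>i\<in>I. f i) \<in> bop"
  by (simp add: bop_def blinfun_apply_sum scaleC_sum_right)

lemma bop_scaleC_op: "T \<in> bop \<Longrightarrow> scaleC_op c T \<in> bop"
  by (simp add: bop_def scaleC_op.rep_eq scaleC_scaleC mult.commute)

lemma nc_eval_carrier: "nc_eval m p T \<in> carrier_mat m m"
  by (simp add: nc_eval_def)

lemma nc_eval_bop:
  assumes "\<And>i. T i \<in> bop" "i < m" "j < m"
  shows "nc_eval m p T $$ (i, j) \<in> bop"
  using assms by (simp add: nc_eval_def bop_sum bop_scaleC_op word_op_bop)

lemma opmat_form_nc_eval: "opmat_form (nc_eval m p T) x = poly_form m p T x"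
proof -
  have "opmat_form (nc_eval m p T) x = (\<Sum>i<m. \<Sum>j<m. \<Sum>\<alpha> | p \<alpha> \<noteq> 0\<^sub>m m m.
      p \<alpha> $$ (i, j) * cinner (blinfun_apply (word_op T \<alpha>) (x j)) (x i))"
    by (simp add: opmat_form_def nc_eval_def blinfun_apply_sum cinner_sum_left scaleC_op.rep_eq
        cinner_scaleC_left)
  also have "\<dots> = (\<Sum>i<m. \<Sum>\<alpha> | p \<alpha> \<noteq> 0\<^sub>m m m. \<Sum>j<m.
      p \<alpha> $$ (i, j) * cinner (blinfun_apply (word_op T \<alpha>) (x j)) (x i))"
    by (intro sum.cong refl sum.swap)
  also have "\<dots> = poly_form m p T x"
    unfolding poly_form_def by (rule sum.swap)
  finally show ?thesis .
qed

lemma opmat_form_Re_nc_eval: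
  assumes "\<And>i. T i \<in> bop"
  shows "opmat_form (opmat_Re (nc_eval m p T)) x = complex_of_real (Re (poly_form m p T x))"
  by (simp add: opmat_form_Re[OF nc_eval_carrier nc_eval_bop] assms opmat_form_nc_eval)

lemma opmat_Re_carrier: "P \<in> carrier_mat m m \<Longrightarrow> opmat_Re P \<in> carrier_mat m m"
  by (auto simp: opmat_Re_def opmat_scaleR_def opmat_adj_def)

lemma opmat_scaleR_carrier: "P \<in> carrier_mat m m \<Longrightarrow> opmat_scaleR r P \<in> carrier_mat m m"
  by (simp add: opmat_scaleR_def)

lemma harnack_form_carrier: "harnack_form \<rho> m p T \<in> carrier_mat m m"
  unfolding harnack_form_def
  by (intro add_carrier_mat opmat_scaleR_carrier opmat_Re_carrier nc_eval_carrier)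

lemma opmat_form_harnack_form:
  assumes "\<And>i. T i \<in> bop"
  shows "opmat_form (harnack_form \<rho> m p T) x = complex_of_real
    (Re (poly_form m p T x) + (\<rho> - 1) * Re (poly_form m p (\<lambda>_. 0) x))"
proof -
  note c = opmat_Re_carrier[OF nc_eval_carrier[of m p]]
  have "opmat_form (harnack_form \<rho> m p T) x = opmat_form (opmat_Re (nc_eval m p T)) x
    + complex_of_real (\<rho> - 1) * opmat_form (opmat_Re (nc_eval m p (\<lambda>_. 0))) x"
    unfolding harnack_form_def
    by (subst opmat_form_add[of _ m]) (simp_all only: opmat_form_scaleR opmat_scaleR_carrier[OF c] c)
  then show ?thesis
    using assms by (simp add: opmat_form_Re_nc_eval bop_zero)
qed

text \<open>The compared matrices are self-adjoint, so only real parts of forms remain. At the zero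
  tuple, Re p(0) + (rho - 1) Re p(0) collapses to rho Re p(0).\<close>

lemma harnack_dominated_zero_iff:
  fixes A :: "'n::finite \<Rightarrow> 'h::chilbert \<Rightarrow>\<^sub>L 'h"
  assumes A: "\<And>i. A i \<in> bop"
  shows "harnack_dominated TYPE('k::chilbert) \<rho> A (\<lambda>_. 0) \<longleftrightarrow>
    (\<exists>c>0. \<forall>m. \<forall>p \<in> nc_polys m.
      (\<forall>X :: 'n \<Rightarrow> 'k \<Rightarrow>\<^sub>L 'k. X \<in> open_row_ball \<longrightarrow> (\<forall>x. 0 \<le> Re (poly_form m p X x))) \<longrightarrow>
      (\<forall>x. Re (poly_form m p A x) + (\<rho> - 1) * Re (poly_form m p (\<lambda>_. 0) x)
         \<le> c\<^sup>2 * (\<rho> * Re (poly_form m p (\<lambda>_. 0) x))))"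
proof -
  have pos: "opmat_nonneg (opmat_Re (nc_eval m p X)) \<longleftrightarrow> (\<forall>x. 0 \<le> Re (poly_form m p X x))"
    if "X \<in> open_row_ball" for m p and X :: "'n \<Rightarrow> 'k \<Rightarrow>\<^sub>L 'k"
    using that by (simp add: opmat_nonneg_iff open_row_ball_def opmat_form_Re_nc_eval)
  have "opmat_scaleR r (harnack_form \<rho> m p T) \<in> carrier_mat m m"
    for r m p and T :: "'n \<Rightarrow> 'h \<Rightarrow>\<^sub>L 'h"
    using harnack_form_carrier[of \<rho> m p T] by (simp add: opmat_scaleR_def)
  then have le: "opmat_le (harnack_form \<rho> m p A) (opmat_scaleR (c\<^sup>2) (harnack_form \<rho> m p (\<lambda>_. 0))) \<longleftrightarrow>
    (\<forall>x. Re (poly_form m p A x) + (\<rho> - 1) * Re (poly_form m p (\<lambda>_. 0) x)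
         \<le> c\<^sup>2 * (\<rho> * Re (poly_form m p (\<lambda>_. 0) x)))" for c m p
    by (simp add: opmat_le_def opmat_nonneg_iff opmat_form_minus[OF _ harnack_form_carrier]
        opmat_form_scaleR opmat_form_harnack_form A bop_zero algebra_simps)
  show ?thesis
    unfolding harnack_dominated_def le using pos by (auto cong: conj_cong imp_cong)
qed

section \<open>Domination bounds the spectral radius\<close>

definition tail_sum ::
    "('n::finite \<Rightarrow> 'a::chilbert \<Rightarrow>\<^sub>L 'a) \<Rightarrow> nat \<Rightarrow> ('n list \<Rightarrow> 'a) \<Rightarrow> 'n list \<Rightarrow> 'a" where
  "tail_sum T N x \<delta> =
     (\<Sum>\<alpha> | length \<delta> + length \<alpha> \<le> N. blinfun_apply (word_op T \<alpha>) (x (\<delta> @ \<alpha>)))"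

text \<open>The form of the multi-Toeplitz kernel with the identity on the diagonal, T_\<alpha> at
  the pair (\<delta>, \<delta>\<alpha>) and its adjoint at (\<delta>\<alpha>, \<delta>). The
  subtracted square corrects the diagonal, which the doubled term counts twice.\<close>

definition toeplitz_form ::
    "('n::finite \<Rightarrow> 'a::chilbert \<Rightarrow>\<^sub>L 'a) \<Rightarrow> nat \<Rightarrow> ('n list \<Rightarrow> 'a) \<Rightarrow> real" where
  "toeplitz_form T N x =
     (\<Sum>\<delta> | length \<delta> \<le> N. 2 * inner (tail_sum T N x \<delta>) (x \<delta>) - (norm (x \<delta>))\<^sup>2)"

lemma finite_words_add_le: "finite {\<alpha> :: 'n::finite list. k + length \<alpha> \<le> N}"
  by (rule finite_subset[OF _ finite_words_le[of N]]) auto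

lemma tail_sum_beyond: "N < length \<delta> \<Longrightarrow> tail_sum T N x \<delta> = 0"
  by (simp add: tail_sum_def)

text \<open>The empty word contributes \<open>x \<delta>\<close>; the other words are sorted by
  their first letter.\<close>

lemma tail_sum_rec:
  fixes T :: "'n::finite \<Rightarrow> 'a::chilbert \<Rightarrow>\<^sub>L 'a"
  assumes "length \<delta> \<le> N"
  shows "tail_sum T N x \<delta> = x \<delta> + (\<Sum>i\<in>UNIV. blinfun_apply (T i) (tail_sum T N x (\<delta> @ [i])))"
proof -
  let ?B = "{\<beta> :: 'n list. Suc (length \<delta>) + length \<beta> \<le> N}"
  let ?g = "\<lambda>\<alpha>. blinfun_apply (word_op T \<alpha>) (x (\<delta> @ \<alpha>))"
  have words: "{\<alpha> :: 'n list. length \<delta> + length \<alpha> \<le> N} = insert [] ((\<lambda>(i, \<beta>). i # \<beta>) ` (UNIV \<times> ?B))"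
  proof (rule Set.set_eqI)
    fix \<alpha> :: "'n list"
    show "\<alpha> \<in> {\<alpha>. length \<delta> + length \<alpha> \<le> N} \<longleftrightarrow> \<alpha> \<in> insert [] ((\<lambda>(i, \<beta>). i # \<beta>) ` (UNIV \<times> ?B))"
      using assms by (cases \<alpha>) auto
  qed
  have fin: "finite ((\<lambda>(i, \<beta>). i # \<beta>) ` ((UNIV :: 'n set) \<times> ?B))"
    by (intro finite_imageI finite_cartesian_product finite_words_add_le) simp
  have "tail_sum T N x \<delta> = x \<delta> + (\<Sum>\<alpha>\<in>(\<lambda>(i, \<beta>). i # \<beta>) ` (UNIV \<times> ?B). ?g \<alpha>)"
    unfolding tail_sum_def words by (subst sum.insert[OF fin]) auto
  also have "(\<Sum>\<alpha>\<in>(\<lambda>(i, \<beta>). i # \<beta>) ` (UNIV \<times> ?B). ?g \<alpha>) = (\<Sum>(i, \<beta>)\<in>UNIV \<times> ?B. ?g (i # \<beta>))"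
    by (subst sum.reindex) (auto simp: inj_on_def case_prod_beta)
  also have "\<dots> = (\<Sum>i\<in>UNIV. \<Sum>\<beta>\<in>?B. ?g (i # \<beta>))"
    by (rule sum.cartesian_product[symmetric])
  also have "\<dots> = (\<Sum>i\<in>UNIV. blinfun_apply (T i) (tail_sum T N x (\<delta> @ [i])))"
    by (simp add: tail_sum_def blinfun.sum_right)
  finally show ?thesis .
qed

text \<open>Every nonempty word is \<open>\<delta> @ [i]\<close> in exactly one way. The left side
  also reaches words of length N + 1, where g vanishes by assumption.\<close>

lemma sum_words_snoc:
  fixes g :: "'n::finite list \<Rightarrow> 'b::ab_group_add"
  assumes "\<And>\<delta>. N < length \<delta> \<Longrightarrow> g \<delta> = 0"
  shows "(\<Sum>\<delta> | length \<delta> \<le> N. \<Sum>i\<in>UNIV. g (\<delta> @ [i])) = (\<Sum>\<delta> | length \<delta> \<le> N. g \<delta>) - g []"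
proof -
  let ?S = "{\<delta> :: 'n list. length \<delta> \<le> N} \<times> (UNIV :: 'n set)"
  have fin: "finite ((\<lambda>(\<delta>, i). \<delta> @ [i]) ` ?S)"
    by (intro finite_imageI finite_cartesian_product finite_words_le) simp
  have "(\<Sum>\<delta> | length \<delta> \<le> N. \<Sum>i\<in>UNIV. g (\<delta> @ [i])) = (\<Sum>(\<delta>, i)\<in>?S. g (\<delta> @ [i]))"
    by (rule sum.cartesian_product)
  also have "\<dots> = (\<Sum>\<gamma>\<in>(\<lambda>(\<delta>, i). \<delta> @ [i]) ` ?S. g \<gamma>)"
    by (subst sum.reindex) (auto simp: inj_on_def case_prod_beta)
  also have "\<dots> = (\<Sum>\<gamma>\<in>insert [] ((\<lambda>(\<delta>, i). \<delta> @ [i]) ` ?S). g \<gamma>) - g []"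
    by (subst sum.insert[OF fin]) auto
  also have "(\<Sum>\<gamma>\<in>insert [] ((\<lambda>(\<delta>, i). \<delta> @ [i]) ` ?S). g \<gamma>) = (\<Sum>\<gamma> | length \<gamma> \<le> N. g \<gamma>)"
  proof (rule sum.mono_neutral_right)
    show "{\<gamma>. length \<gamma> \<le> N} \<subseteq> insert [] ((\<lambda>(\<delta>, i). \<delta> @ [i]) ` ?S)"
    proof
      fix \<gamma> :: "'n list" assume "\<gamma> \<in> {\<gamma>. length \<gamma> \<le> N}"
      then show "\<gamma> \<in> insert [] ((\<lambda>(\<delta>, i). \<delta> @ [i]) ` ?S)"
        by (cases \<gamma> rule: rev_cases) auto
    qed
  qed (use fin assms in auto)
  finally show ?thesis .
qed

lemma toeplitz_form_eq:
  fixes T :: "'n::finite \<Rightarrow> 'a::chilbert \<Rightarrow>\<^sub>L 'a" and x :: "'n list \<Rightarrow> 'a" and N :: nat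
  defines "z \<equiv> tail_sum T N x"
  shows "toeplitz_form T N x = (norm (z []))\<^sup>2 + (\<Sum>\<delta> | length \<delta> \<le> N.
    (\<Sum>i\<in>UNIV. (norm (z (\<delta> @ [i])))\<^sup>2) - (norm (\<Sum>i\<in>UNIV. blinfun_apply (T i) (z (\<delta> @ [i]))))\<^sup>2)"
proof -
  let ?w = "\<lambda>\<delta>. \<Sum>i\<in>UNIV. blinfun_apply (T i) (z (\<delta> @ [i]))"
  have "2 * inner (z \<delta>) (x \<delta>) - (norm (x \<delta>))\<^sup>2 = (norm (z \<delta>))\<^sup>2 - (norm (?w \<delta>))\<^sup>2"
    if "length \<delta> \<le> N" for \<delta>
  proof -
    have "?w \<delta> = z \<delta> - x \<delta>"
      using tail_sum_rec[OF that, of T x] by (simp add: z_def)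
    then have "(norm (?w \<delta>))\<^sup>2 = (norm (z \<delta>))\<^sup>2 - 2 * inner (z \<delta>) (x \<delta>) + (norm (x \<delta>))\<^sup>2"
      by (simp add: power2_norm_eq_inner inner_diff_left inner_diff_right inner_commute)
    then show ?thesis
      by simp
  qed
  then have "toeplitz_form T N x = (\<Sum>\<delta> | length \<delta> \<le> N. (norm (z \<delta>))\<^sup>2 - (norm (?w \<delta>))\<^sup>2)"
    by (simp add: toeplitz_form_def z_def)
  moreover have "(\<Sum>\<delta> | length \<delta> \<le> N. \<Sum>i\<in>UNIV. (norm (z (\<delta> @ [i])))\<^sup>2) =
      (\<Sum>\<delta> | length \<delta> \<le> N. (norm (z \<delta>))\<^sup>2) - (norm (z []))\<^sup>2"
    by (rule sum_words_snoc) (simp add: z_def tail_sum_beyond)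
  ultimately show ?thesis
    by (simp add: sum_subtractf)
qed

lemma toeplitz_form_nonneg:
  assumes "X \<in> open_row_ball"
  shows "0 \<le> toeplitz_form X N x"
proof -
  have "0 \<le> (\<Sum>i\<in>UNIV. (norm (z i))\<^sup>2) - (norm (\<Sum>i\<in>UNIV. blinfun_apply (X i) (z i)))\<^sup>2" for z
    using norm_row_sum_le[of UNIV X z] assms by (simp add: open_row_ball_def)
  then show ?thesis
    unfolding toeplitz_form_eq by (intro add_nonneg_nonneg sum_nonneg) auto
qed

text \<open>Orthogonal ranges make the row of the V_i isometric, so every summand of
  \<open>toeplitz_form_eq\<close> except the first term is zero.\<close>

lemma toeplitz_form_isometries:
  fixes V :: "'n::finite \<Rightarrow> 'a::chilbert \<Rightarrow>\<^sub>L 'a"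
  assumes iso: "\<And>i x. norm (blinfun_apply (V i) x) = norm x"
    and orth: "\<And>i j x y. i \<noteq> j \<Longrightarrow> cinner (blinfun_apply (V i) x) (blinfun_apply (V j) y) = 0"
  shows "toeplitz_form V N x = (norm (tail_sum V N x []))\<^sup>2"
proof -
  have "(norm (\<Sum>i\<in>UNIV. blinfun_apply (V i) (z i)))\<^sup>2 = (\<Sum>i\<in>UNIV. (norm (z i))\<^sup>2)" for z
  proof -
    have "inner (blinfun_apply (V i) (z i)) (blinfun_apply (V j) (z j)) =
      (if i = j then (norm (z i))\<^sup>2 else 0)" for i j
    proof (cases "i = j")
      case True
      then show ?thesis
        by (simp add: power2_norm_eq_inner[symmetric] iso)
    next
      case False
      then show ?thesis
        by (simp add: inner_eq_Re_cinner orth)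
    qed
    then show ?thesis
      by (simp add: power2_norm_eq_inner[of "sum _ _"] inner_sum_left inner_sum_right)
  qed
  then show ?thesis
    unfolding toeplitz_form_eq by simp
qed

lemma toeplitz_form_zero:
  fixes x :: "'n::finite list \<Rightarrow> 'a::chilbert"
  shows "toeplitz_form (\<lambda>_. 0) N x = (\<Sum>\<delta> | length \<delta> \<le> N. (norm (x \<delta>))\<^sup>2)"
  unfolding toeplitz_form_def
proof (rule sum.cong[OF refl])
  fix \<delta> :: "'n list" assume "\<delta> \<in> {\<delta>. length \<delta> \<le> N}"
  then have "tail_sum (\<lambda>_. 0) N x \<delta> = x \<delta>"
    by (simp add: tail_sum_rec)
  then show "2 * inner (tail_sum (\<lambda>_. 0) N x \<delta>) (x \<delta>) - (norm (x \<delta>))\<^sup>2 = (norm (x \<delta>))\<^sup>2"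
    by (simp add: power2_norm_eq_inner)
qed

text \<open>Here \<open>f\<close> numbers the words of length at most N, so the entries are indexed
  by pairs of words. The 2 at nonempty words is needed because the real part of the form halves each
  off-diagonal pair.\<close>

definition toeplitz_poly :: "nat \<Rightarrow> (nat \<Rightarrow> 'n list) \<Rightarrow> 'n list \<Rightarrow> complex mat" where
  "toeplitz_poly m f \<alpha> = Matrix.mat m m
     (\<lambda>(i, j). if f j = f i @ \<alpha> then if \<alpha> = [] then 1 else 2 else 0)"

lemma toeplitz_poly_support:
  assumes "bij_betw f {..<m} {\<gamma> :: 'n::finite list. length \<gamma> \<le> N}"
  shows "{\<alpha>. toeplitz_poly m f \<alpha> \<noteq> 0\<^sub>m m m} \<subseteq> {\<alpha>. length \<alpha> \<le> N}"
proof
  fix \<alpha> assume \<alpha>: "\<alpha> \<in> {\<alpha>. toeplitz_poly m f \<alpha> \<noteq> 0\<^sub>m m m}"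
  show "\<alpha> \<in> {\<alpha>. length \<alpha> \<le> N}"
  proof (rule ccontr)
    assume long: "\<alpha> \<notin> {\<alpha>. length \<alpha> \<le> N}"
    have "toeplitz_poly m f \<alpha> = 0\<^sub>m m m"
    proof (rule eq_matI)
      fix i j assume "i < dim_row (0\<^sub>m m m :: complex mat)" "j < dim_col (0\<^sub>m m m :: complex mat)"
      then have ij: "i < m" "j < m"
        by auto
      then have "length (f j) \<le> N"
        using assms by (auto simp: bij_betw_def)
      then have "f j \<noteq> f i @ \<alpha>"
        using long by auto
      then show "toeplitz_poly m f \<alpha> $$ (i, j) = 0\<^sub>m m m $$ (i, j)"
        using ij by (simp add: toeplitz_poly_def)
    qed (auto simp: toeplitz_poly_def)
    with \<alpha> show False
      by simp
  qed
qed

lemma toeplitz_poly_nc_polys: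
  assumes "bij_betw f {..<m} {\<gamma> :: 'n::finite list. length \<gamma> \<le> N}"
  shows "toeplitz_poly m f \<in> nc_polys m"
  using finite_subset[OF toeplitz_poly_support[OF assms] finite_words_le]
  by (simp add: nc_polys_def toeplitz_poly_def)

lemma poly_form_toeplitz:
  fixes T :: "'n::finite \<Rightarrow> 'a::chilbert \<Rightarrow>\<^sub>L 'a"
  assumes f: "bij_betw f {..<m} {\<gamma> :: 'n list. length \<gamma> \<le> N}"
    and y: "\<And>i. i < m \<Longrightarrow> y i = x (f i)"
  shows "Re (poly_form m (toeplitz_poly m f) T y) = toeplitz_form T N x"
proof -
  let ?W = "{\<gamma> :: 'n list. length \<gamma> \<le> N}"
  let ?c = "\<lambda>\<alpha> :: 'n list. if \<alpha> = [] then 1 else 2 :: real"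
  let ?t = "\<lambda>\<alpha> \<delta> \<gamma>. inner (blinfun_apply (word_op T \<alpha>) (x \<gamma>)) (x \<delta>)"
  have re: "Re (toeplitz_poly m f \<alpha> $$ (i, j) * cinner (blinfun_apply (word_op T \<alpha>) (y j)) (y i))
    = (if f j = f i @ \<alpha> then ?c \<alpha> * ?t \<alpha> (f i) (f j) else 0)" if "i < m" "j < m" for \<alpha> i j
    using that by (simp add: toeplitz_poly_def y Re_cinner)
  have "Re (poly_form m (toeplitz_poly m f) T y) = (\<Sum>\<alpha>\<in>?W. \<Sum>i<m. \<Sum>j<m.
      if f j = f i @ \<alpha> then ?c \<alpha> * ?t \<alpha> (f i) (f j) else 0)"
    by (simp add: poly_form_superset[OF finite_words_le toeplitz_poly_support[OF f]] re
        del: times_complex.sel mult_eq_0_iff)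
  also have "\<dots> = (\<Sum>\<alpha>\<in>?W. \<Sum>\<delta>\<in>?W. \<Sum>\<gamma>\<in>?W. if \<gamma> = \<delta> @ \<alpha> then ?c \<alpha> * ?t \<alpha> \<delta> \<gamma> else 0)"
    by (simp only: sum.reindex_bij_betw[OF f, symmetric])
  \<comment> \<open>For given \<delta> and \<alpha> there is just one candidate for \<gamma>, and it
    is in range exactly when the lengths add up to at most N.\<close>
  also have "\<dots> = (\<Sum>\<alpha>\<in>?W. \<Sum>\<delta>\<in>?W. if length \<delta> + length \<alpha> \<le> N then ?c \<alpha> * ?t \<alpha> \<delta> (\<delta> @ \<alpha>) else 0)"
    by (intro sum.cong refl, subst sum.delta[OF finite_words_le]) simp
  also have "\<dots> = (\<Sum>\<delta>\<in>?W. \<Sum>\<alpha>\<in>?W. if length \<delta> + length \<alpha> \<le> N then ?c \<alpha> * ?t \<alpha> \<delta> (\<delta> @ \<alpha>) else 0)"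
    by (rule sum.swap)
  also have "\<dots> = toeplitz_form T N x"
    unfolding toeplitz_form_def
  proof (rule sum.cong[OF refl])
    fix \<delta> assume \<delta>: "\<delta> \<in> ?W"
    let ?S = "{\<alpha> :: 'n list. length \<delta> + length \<alpha> \<le> N}"
    have "(\<Sum>\<alpha>\<in>?W. if length \<delta> + length \<alpha> \<le> N then ?c \<alpha> * ?t \<alpha> \<delta> (\<delta> @ \<alpha>) else 0)
      = (\<Sum>\<alpha>\<in>?S. ?c \<alpha> * ?t \<alpha> \<delta> (\<delta> @ \<alpha>))"
      by (rule sum.mono_neutral_cong_right[OF finite_words_le]) auto
    also have "\<dots> = (\<Sum>\<alpha>\<in>?S. 2 * ?t \<alpha> \<delta> (\<delta> @ \<alpha>) - (if \<alpha> = [] then (norm (x \<delta>))\<^sup>2 else 0))"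
      by (rule sum.cong) (auto simp: power2_norm_eq_inner)
    also have "\<dots> = 2 * inner (tail_sum T N x \<delta>) (x \<delta>) - (norm (x \<delta>))\<^sup>2"
      using \<delta> by (simp add: sum_subtractf sum.delta[OF finite_words_add_le] tail_sum_def
          inner_sum_left sum_distrib_left)
    finally show "(\<Sum>\<alpha>\<in>?W. if length \<delta> + length \<alpha> \<le> N then ?c \<alpha> * ?t \<alpha> \<delta> (\<delta> @ \<alpha>) else 0)
      = 2 * inner (tail_sum T N x \<delta>) (x \<delta>) - (norm (x \<delta>))\<^sup>2" .
  qed
  finally show ?thesis .
qed

text \<open>Weak form of the dilation identity: the projection is J after J^*, and the injective J
  can be cancelled.\<close>

lemma class_C_dilation:
  fixes A :: "'n::finite \<Rightarrow> 'h::chilbert \<Rightarrow>\<^sub>L 'h"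
  assumes "A \<in> class_C TYPE('g) \<rho>"
  obtains J :: "'h \<Rightarrow>\<^sub>L 'g::chilbert" and V :: "'n \<Rightarrow> 'g \<Rightarrow>\<^sub>L 'g" where
    "\<And>x. norm (blinfun_apply J x) = norm x"
    "\<And>i x. norm (blinfun_apply (V i) x) = norm x"
    "\<And>i j x y. i \<noteq> j \<Longrightarrow> cinner (blinfun_apply (V i) x) (blinfun_apply (V j) y) = 0"
    "\<And>\<alpha> x y. \<alpha> \<noteq> [] \<Longrightarrow> inner (blinfun_apply (word_op A \<alpha>) x) y =
       \<rho> * inner (blinfun_apply (word_op V \<alpha>) (blinfun_apply J x)) (blinfun_apply J y)"
proof -
  obtain J :: "'h \<Rightarrow>\<^sub>L 'g" and V :: "'n \<Rightarrow> 'g \<Rightarrow>\<^sub>L 'g" where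
    JV: "J \<in> bop \<and> (\<forall>x. norm (blinfun_apply J x) = norm x) \<and>
      (\<forall>i. V i \<in> bop \<and> (\<forall>x. norm (blinfun_apply (V i) x) = norm x)) \<and>
      (\<forall>i j x y. i \<noteq> j \<longrightarrow> cinner (blinfun_apply (V i) x) (blinfun_apply (V j) y) = 0) \<and>
      (\<forall>\<alpha>. \<alpha> \<noteq> [] \<longrightarrow> (\<forall>x. blinfun_apply J (blinfun_apply (word_op A \<alpha>) x) =
        \<rho> *\<^sub>R orth_proj (range (blinfun_apply J)) (blinfun_apply (word_op V \<alpha>) (blinfun_apply J x))))"
    using assms unfolding class_C_def mem_Collect_eq by (elim conjE exE) (rule that; intro conjI; assumption)
  have J: "J \<in> bop" "\<And>x. norm (blinfun_apply J x) = norm x"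
    and V: "\<And>i x. norm (blinfun_apply (V i) x) = norm x"
    "\<And>i j x y. i \<noteq> j \<Longrightarrow> cinner (blinfun_apply (V i) x) (blinfun_apply (V j) y) = 0"
    and dil: "\<And>\<alpha> x. \<alpha> \<noteq> [] \<Longrightarrow> blinfun_apply J (blinfun_apply (word_op A \<alpha>) x) =
       \<rho> *\<^sub>R orth_proj (range (blinfun_apply J)) (blinfun_apply (word_op V \<alpha>) (blinfun_apply J x))"
    using JV by simp_all
  have J_inj: "u = v" if "blinfun_apply J u = blinfun_apply J v" for u v
    using arg_cong[OF that, of "blinfun_apply (op_adj J)"] by (simp only: orth_proj_range(2)[OF J])
  have "inner (blinfun_apply (word_op A \<alpha>) x) y =
      \<rho> * inner (blinfun_apply (word_op V \<alpha>) (blinfun_apply J x)) (blinfun_apply J y)"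
    if "\<alpha> \<noteq> []" for \<alpha> x y
  proof -
    let ?v = "blinfun_apply (word_op V \<alpha>) (blinfun_apply J x)"
    have "blinfun_apply J (blinfun_apply (word_op A \<alpha>) x) =
        blinfun_apply J (\<rho> *\<^sub>R blinfun_apply (op_adj J) ?v)"
      by (simp add: dil[OF that] orth_proj_range[OF J] blinfun.scaleR_right)
    then have "blinfun_apply (word_op A \<alpha>) x = \<rho> *\<^sub>R blinfun_apply (op_adj J) ?v"
      by (rule J_inj)
    then show ?thesis
      using inner_op_adj[OF J(1), of y ?v] by (simp add: inner_commute)
  qed
  from J(2) V this show thesis
    by (rule that)
qed

text \<open>Each nonempty word of A carries a factor rho. The diagonal entries 1 become 1 + (rho -
  1) = rho, so the factor can be taken out of the whole form.\<close>

lemma toeplitz_form_dilation: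
  fixes A :: "'n::finite \<Rightarrow> 'h::chilbert \<Rightarrow>\<^sub>L 'h" and V :: "'n \<Rightarrow> 'g::chilbert \<Rightarrow>\<^sub>L 'g"
  assumes J: "\<And>x. norm (blinfun_apply J x) = norm x"
    and dil: "\<And>\<alpha> x y. \<alpha> \<noteq> [] \<Longrightarrow> inner (blinfun_apply (word_op A \<alpha>) x) y =
       \<rho> * inner (blinfun_apply (word_op V \<alpha>) (blinfun_apply J x)) (blinfun_apply J y)"
  shows "toeplitz_form A N x + (\<rho> - 1) * (\<Sum>\<delta> | length \<delta> \<le> N. (norm (x \<delta>))\<^sup>2) =
    \<rho> * toeplitz_form V N (\<lambda>\<delta>. blinfun_apply J (x \<delta>))"
proof -
  have tail: "inner (tail_sum A N x \<delta>) (x \<delta>) - (norm (x \<delta>))\<^sup>2 =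
    \<rho> * (inner (tail_sum V N (\<lambda>\<delta>. blinfun_apply J (x \<delta>)) \<delta>) (blinfun_apply J (x \<delta>)) - (norm (x \<delta>))\<^sup>2)"
    if "length \<delta> \<le> N" for \<delta>
  proof -
    let ?S = "{\<alpha> :: 'n list. length \<delta> + length \<alpha> \<le> N}"
    let ?a = "\<lambda>\<alpha>. inner (blinfun_apply (word_op A \<alpha>) (x (\<delta> @ \<alpha>))) (x \<delta>)"
    let ?v = "\<lambda>\<alpha>. inner (blinfun_apply (word_op V \<alpha>) (blinfun_apply J (x (\<delta> @ \<alpha>)))) (blinfun_apply J (x \<delta>))"
    have Nil: "[] \<in> ?S" "?a [] = (norm (x \<delta>))\<^sup>2" "?v [] = (norm (x \<delta>))\<^sup>2"
      using that by (simp_all add: power2_norm_eq_inner[symmetric] J)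
    have "inner (tail_sum A N x \<delta>) (x \<delta>) = ?a [] + sum ?a (?S - {[]})"
      using sum.remove[OF finite_words_add_le Nil(1), of ?a] by (simp add: tail_sum_def inner_sum_left)
    moreover have "inner (tail_sum V N (\<lambda>\<delta>. blinfun_apply J (x \<delta>)) \<delta>) (blinfun_apply J (x \<delta>))
        = ?v [] + sum ?v (?S - {[]})"
      using sum.remove[OF finite_words_add_le Nil(1), of ?v] by (simp add: tail_sum_def inner_sum_left)
    moreover have "sum ?a (?S - {[]}) = \<rho> * sum ?v (?S - {[]})"
      unfolding sum_distrib_left by (rule sum.cong) (auto intro: dil)
    ultimately show ?thesis
      by (simp only: Nil add_diff_cancel_left')
  qed
  have "2 * inner (tail_sum A N x \<delta>) (x \<delta>) - (norm (x \<delta>))\<^sup>2 + (\<rho> - 1) * (norm (x \<delta>))\<^sup>2 =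
    \<rho> * (2 * inner (tail_sum V N (\<lambda>\<delta>. blinfun_apply J (x \<delta>)) \<delta>) (blinfun_apply J (x \<delta>))
      - (norm (blinfun_apply J (x \<delta>)))\<^sup>2)" if "length \<delta> \<le> N" for \<delta>
    using tail[OF that] by (simp add: J algebra_simps)
  then show ?thesis
    by (simp add: toeplitz_form_def sum_distrib_left sum.distrib[symmetric])
qed

text \<open>Summability for each y becomes uniform decay: the term of index M + 1 is at most D times
  each earlier one, hence M times it is at most D^2 |y|^2. Any M > D^2 gives a row norm below
  1.\<close>

lemma row_sum_bounded_imp_jsr:
  fixes T :: "'n::finite \<Rightarrow> 'a::chilbert \<Rightarrow>\<^sub>L 'a"
  assumes T: "\<And>i. T i \<in> bop" and D: "0 \<le> D"
    and le: "\<And>N y. (\<Sum>k=1..N. row_sum T k y) \<le> D * (norm y)\<^sup>2"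
  shows "joint_spectral_radius T < 1"
proof -
  have row_nonneg: "0 \<le> row_sum T k y" for k y
    by (simp add: row_sum_def sum_nonneg)
  have single: "row_sum T k y \<le> D * (norm y)\<^sup>2" if "1 \<le> k" for k y
  proof -
    have "row_sum T k y \<le> (\<Sum>k=1..k. row_sum T k y)"
      using that row_nonneg by (intro member_le_sum) auto
    with le[where N = k and y = y] show ?thesis
      by simp
  qed
  \<comment> \<open>After k letters are split off, \<open>single\<close> bounds the remaining N + 1
    - k letters at the vectors T_\<alpha>^* y; at least one letter remains because k <= N.\<close>
  have step: "row_sum T (Suc N) y \<le> D * row_sum T k y" if "1 \<le> k" "k \<le> N" for N k y
  proof -
    have "row_sum T (Suc N) y = (\<Sum>\<alpha> | length \<alpha> = k.
        row_sum T (Suc N - k) (blinfun_apply (op_adj (word_op T \<alpha>)) y))"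
      using row_sum_add[OF T, where k = k and l = "Suc N - k" and y = y] that by simp
    also have "\<dots> \<le> (\<Sum>\<alpha> | length \<alpha> = k. D * (norm (blinfun_apply (op_adj (word_op T \<alpha>)) y))\<^sup>2)"
      using that by (intro sum_mono single) simp
    finally show ?thesis
      by (simp add: row_sum_def sum_distrib_left)
  qed
  obtain M where M: "D * D < real M"
    using reals_Archimedean2 by blast
  with D have M0: "0 < real M"
    by (smt (verit) mult_nonneg_nonneg)
  have "row_norm T (Suc M) \<le> D * D / real M"
  proof (rule row_norm_le[OF T])
    fix y
    have "real M * row_sum T (Suc M) y = (\<Sum>k=1..M. row_sum T (Suc M) y)"
      by simp
    also have "\<dots> \<le> (\<Sum>k=1..M. D * row_sum T k y)"
      by (intro sum_mono step) auto
    also have "\<dots> \<le> D * (D * (norm y)\<^sup>2)"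
      unfolding sum_distrib_left[symmetric] by (intro mult_left_mono le D)
    finally show "row_sum T (Suc M) y \<le> D * D / real M * (norm y)\<^sup>2"
      using M0 by (simp add: field_simps)
  qed (use D M0 in auto)
  also have "\<dots> < 1"
    using M M0 by simp
  finally show ?thesis
    unfolding joint_spectral_radius_less_one_iff[OF T] by (intro exI[of _ "Suc M"]) simp
qed

lemma sum_words_by_length:
  fixes g :: "'n::finite list \<Rightarrow> 'b::comm_monoid_add"
  shows "(\<Sum>\<delta>\<in>{\<delta>. length \<delta> \<le> N} - {[]}. g \<delta>) = (\<Sum>k=1..N. \<Sum>\<delta> | length \<delta> = k. g \<delta>)"
proof -
  have "{\<delta> :: 'n list. length \<delta> \<le> N} - {[]} = (\<Union>k\<in>{1..N}. {\<delta>. length \<delta> = k})"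
    by (auto simp: Suc_le_eq)
  then show ?thesis
    by (simp only:) (subst sum.UNION_disjoint, auto simp: finite_words_eq)
qed

lemma jsr_of_harnack:
  fixes A :: "'n::finite \<Rightarrow> 'h::chilbert \<Rightarrow>\<^sub>L 'h"
  assumes \<rho>: "\<rho> > 0" and C: "A \<in> class_C TYPE('g::chilbert) \<rho>"
    and H: "harnack_dominated TYPE('k::chilbert) \<rho> A (\<lambda>_. 0)"
  shows "joint_spectral_radius A < 1"
proof -
  have A: "A i \<in> bop" for i
    using C by (simp add: class_C_def)
  obtain J :: "'h \<Rightarrow>\<^sub>L 'g" and V :: "'n \<Rightarrow> 'g \<Rightarrow>\<^sub>L 'g" where
    J: "\<And>x. norm (blinfun_apply J x) = norm x" and
    V: "\<And>i x. norm (blinfun_apply (V i) x) = norm x"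
    "\<And>i j x y. i \<noteq> j \<Longrightarrow> cinner (blinfun_apply (V i) x) (blinfun_apply (V j) y) = 0" and
    dil: "\<And>\<alpha> x y. \<alpha> \<noteq> [] \<Longrightarrow> inner (blinfun_apply (word_op A \<alpha>) x) y =
       \<rho> * inner (blinfun_apply (word_op V \<alpha>) (blinfun_apply J x)) (blinfun_apply J y)"
    by (rule class_C_dilation[OF C]) (rule that; assumption)
  obtain c where c: "c > 0" and dom: "\<forall>m. \<forall>p \<in> nc_polys m.
      (\<forall>X :: 'n \<Rightarrow> 'k \<Rightarrow>\<^sub>L 'k. X \<in> open_row_ball \<longrightarrow> (\<forall>x. 0 \<le> Re (poly_form m p X x))) \<longrightarrow>
      (\<forall>x. Re (poly_form m p A x) + (\<rho> - 1) * Re (poly_form m p (\<lambda>_. 0) x)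
         \<le> c\<^sup>2 * (\<rho> * Re (poly_form m p (\<lambda>_. 0) x)))"
    using H unfolding harnack_dominated_zero_iff[OF A] by (elim exE conjE)
  have H: "Re (poly_form m p A x) + (\<rho> - 1) * Re (poly_form m p (\<lambda>_. 0) x)
      \<le> c\<^sup>2 * (\<rho> * Re (poly_form m p (\<lambda>_. 0) x))"
    if "p \<in> nc_polys m" "\<And>(X :: 'n \<Rightarrow> 'k \<Rightarrow>\<^sub>L 'k) x. X \<in> open_row_ball \<Longrightarrow> 0 \<le> Re (poly_form m p X x)"
    for m p x
    using bspec[OF spec[OF dom, of m] that(1)] that(2) by simp
  \<comment> \<open>Domination is applied to the Toeplitz polynomial. Its form at A plus the rho - 1
    correction is rho times the dilation form, and the common factor rho cancels.\<close>
  have bound: "(norm (tail_sum V N (\<lambda>\<delta>. blinfun_apply J (x \<delta>)) []))\<^sup>2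
      \<le> c\<^sup>2 * (\<Sum>\<delta> | length \<delta> \<le> N. (norm (x \<delta>))\<^sup>2)" for N x
  proof -
    obtain f and m :: nat where f: "bij_betw f {..<m} {\<gamma> :: 'n list. length \<gamma> \<le> N}"
      using ex_bij_betw_nat_finite[OF finite_words_le[of N, where ?'n = 'n]] unfolding atLeast0LessThan by blast
    have pos: "0 \<le> Re (poly_form m (toeplitz_poly m f) X y)"
      if "X \<in> open_row_ball" for y and X :: "'n \<Rightarrow> 'k \<Rightarrow>\<^sub>L 'k"
    proof -
      \<comment> \<open>Any vector tuple on K is a family indexed by words, read back through the
        enumeration; so positivity holds for all of them.\<close>
      have "y i = y (inv_into {..<m} f (f i))" if "i < m" for i
        using f that by (simp add: bij_betw_def)
      then show ?thesis
        using toeplitz_form_nonneg[OF that] by (subst poly_form_toeplitz[OF f]) auto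
    qed
    have "toeplitz_form A N x + (\<rho> - 1) * toeplitz_form (\<lambda>_. 0) N x
        \<le> c\<^sup>2 * (\<rho> * toeplitz_form (\<lambda>_. 0) N x)"
      using H[OF toeplitz_poly_nc_polys[OF f] pos, of "\<lambda>i. x (f i)"]
      by (simp add: poly_form_toeplitz[OF f, of _ x])
    then have "\<rho> * (norm (tail_sum V N (\<lambda>\<delta>. blinfun_apply J (x \<delta>)) []))\<^sup>2
        \<le> \<rho> * (c\<^sup>2 * (\<Sum>\<delta> | length \<delta> \<le> N. (norm (x \<delta>))\<^sup>2))"
      by (simp add: toeplitz_form_zero toeplitz_form_dilation[OF J dil]
          toeplitz_form_isometries[OF V] mult_ac)
    then show ?thesis
      using \<rho> by simp
  qed
  have "(\<Sum>k=1..N. row_sum A k y) \<le> (\<rho> * c)\<^sup>2 * (norm y)\<^sup>2" for N y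
  proof -
    \<comment> \<open>The empty word gets 0 because \<open>dil\<close> covers nonempty words
      only.\<close>
    define x where "x \<delta> = (if \<delta> = [] then 0 else blinfun_apply (op_adj (word_op A \<delta>)) y)" for \<delta>
    let ?W = "{\<delta> :: 'n list. length \<delta> \<le> N}"
    let ?t = "tail_sum V N (\<lambda>\<delta>. blinfun_apply J (x \<delta>)) []"
    define s where "s = (\<Sum>\<delta>\<in>?W - {[]}. (norm (blinfun_apply (op_adj (word_op A \<delta>)) y))\<^sup>2)"
    have s0: "0 \<le> s"
      by (simp add: s_def sum_nonneg)
    have s_x: "s = (\<Sum>\<delta>\<in>?W. (norm (x \<delta>))\<^sup>2)"
      unfolding s_def
      by (rule sum.mono_neutral_cong_left[OF finite_words_le]) (auto simp: x_def)
    \<comment> \<open>Moving the adjoints back writes s as rho times the inner product of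
      \<open>?t\<close> with J y, while \<open>bound\<close> gives |?t| <= c sqrt s. Hence s <= rho
      c sqrt s |y|, and one factor sqrt s cancels.\<close>
    have "s = (\<Sum>\<delta>\<in>?W - {[]}. inner (blinfun_apply (word_op A \<delta>) (x \<delta>)) y)"
      unfolding s_def
      by (rule sum.cong) (auto simp: x_def inner_op_adj[OF word_op_bop[OF A]] power2_norm_eq_inner)
    also have "\<dots> = (\<Sum>\<delta>\<in>?W. \<rho> * inner (blinfun_apply (word_op V \<delta>) (blinfun_apply J (x \<delta>))) (blinfun_apply J y))"
      by (rule sum.mono_neutral_cong_left[OF finite_words_le]) (auto simp: x_def dil)
    also have "\<dots> = \<rho> * inner ?t (blinfun_apply J y)"
      by (simp add: tail_sum_def inner_sum_left sum_distrib_left)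
    also have "\<dots> \<le> \<rho> * (norm ?t * norm y)"
      using norm_cauchy_schwarz[of ?t "blinfun_apply J y"] \<rho> by (intro mult_left_mono) (auto simp: J)
    also have "\<dots> \<le> \<rho> * (c * sqrt s * norm y)"
    proof -
      have "norm ?t = sqrt ((norm ?t)\<^sup>2)"
        by simp
      also have "\<dots> \<le> sqrt (c\<^sup>2 * s)"
        unfolding s_x by (intro real_sqrt_le_mono bound)
      also have "\<dots> = c * sqrt s"
        using c by (simp add: real_sqrt_mult)
      finally show ?thesis
        using \<rho> by (intro mult_left_mono mult_right_mono) auto
    qed
    finally have "sqrt s * sqrt s \<le> sqrt s * (\<rho> * c * norm y)"
      using s0 by (simp add: mult_ac)
    then have "sqrt s \<le> \<rho> * c * norm y"
    proof (cases "s = 0")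
      case False
      with s0 have "0 < sqrt s"
        by simp
      from mult_le_cancel_left_pos[OF this] \<open>sqrt s * sqrt s \<le> _\<close> show ?thesis
        by blast
    qed (use \<rho> c in simp)
    then have "(sqrt s)\<^sup>2 \<le> (\<rho> * c * norm y)\<^sup>2"
      by (intro power_mono) (auto simp: s0)
    then have "s \<le> (\<rho> * c)\<^sup>2 * (norm y)\<^sup>2"
      using s0 by (simp add: power_mult_distrib)
    then show ?thesis
      by (simp add: s_def sum_words_by_length row_sum_def)
  qed
  then show ?thesis
    by (intro row_sum_bounded_imp_jsr[of A "(\<rho> * c)\<^sup>2"] A) auto
qed

section \<open>Positivity of Schur products and orthonormal systems\<close>

text \<open>Schur product theorem by elimination, for an F whose form merely has nonnegative real
  part. With u the column \<open>a\<close> of G divided by sqrt (G a a), the remainder G - u u^*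
  vanishes in row and column \<open>a\<close> and goes to the induction hypothesis, while u u^*
  contributes the form of F at u. The lower bound e keeps the pivot positive and passes to the
  remainder.\<close>

lemma schur_product_strict:
  fixes F G :: "'i \<Rightarrow> 'i \<Rightarrow> complex"
  assumes "finite I"
    and F: "\<And>h. 0 \<le> Re (\<Sum>i\<in>I. \<Sum>j\<in>I. F i j * h j * cnj (h i))"
    and "\<And>i j. i \<in> I \<Longrightarrow> j \<in> I \<Longrightarrow> G j i = cnj (G i j)"
    and "\<And>h. e * (\<Sum>i\<in>I. (cmod (h i))\<^sup>2) \<le> Re (\<Sum>i\<in>I. \<Sum>j\<in>I. G i j * h j * cnj (h i))"
    and e: "0 < e"
  shows "0 \<le> Re (\<Sum>i\<in>I. \<Sum>j\<in>I. F i j * G j i)"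
  using assms(1-4)
proof (induction I arbitrary: G rule: finite_induct)
  case empty
  show ?case by simp
next
  case (insert a I)
  note F = insert.prems(1) and herm = insert.prems(2) and pos = insert.prems(3)
  have supp: "(\<Sum>i\<in>insert a I. \<Sum>j\<in>insert a I. K i j) = (\<Sum>i\<in>I. \<Sum>j\<in>I. K i j)"
    if "\<And>i. i \<in> insert a I \<Longrightarrow> K i a = 0 \<and> K a i = 0" for K :: "'i \<Rightarrow> 'i \<Rightarrow> complex"
  proof -
    have row: "(\<Sum>j\<in>insert a I. K i j) = (\<Sum>j\<in>I. K i j)" if "i \<in> insert a I" for i
      using \<open>\<And>i. i \<in> insert a I \<Longrightarrow> K i a = 0 \<and> K a i = 0\<close>[OF that] insert.hyps by simp
    have "(\<Sum>j\<in>I. K a j) = 0"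
      using that by (intro sum.neutral) blast
    then show ?thesis
      using insert.hyps by (simp only: row cong: sum.cong) simp
  qed
  define p where "p = Re (G a a)"
  have "Im (G a a) = 0"
    using arg_cong[OF herm[of a a], of Im] by simp
  then have Gaa: "G a a = complex_of_real p"
    by (simp add: p_def complex_eq_iff)
  \<comment> \<open>Testing the lower bound on the unit vector at \<open>a\<close>.\<close>
  have "e \<le> p"
  proof -
    define h :: "'i \<Rightarrow> complex" where "h i = (if i = a then 1 else 0)" for i
    have h: "h i = 0" if "i \<in> I" for i
      using that insert.hyps by (auto simp: h_def)
    have sq: "(\<Sum>i\<in>I. (cmod (h i))\<^sup>2) = 0"
      by (rule sum.neutral) (simp add: h)
    have row: "(\<Sum>j\<in>insert a I. G i j * h j * c) = G i a * c" for i c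
    proof -
      have "(\<Sum>j\<in>I. G i j * h j * c) = 0"
        by (rule sum.neutral) (simp add: h)
      then show ?thesis
        using insert.hyps by (simp add: h_def)
    qed
    have "(\<Sum>i\<in>I. G i a * cnj (h i)) = 0"
      by (rule sum.neutral) (simp add: h)
    then have "(\<Sum>i\<in>insert a I. \<Sum>j\<in>insert a I. G i j * h j * cnj (h i)) = G a a"
      unfolding row using insert.hyps by (simp add: h_def)
    moreover have "(\<Sum>i\<in>insert a I. (cmod (h i))\<^sup>2) = 1"
      using insert.hyps sq by (simp add: h_def)
    ultimately show ?thesis
      using pos[of h] by (simp add: p_def)
  qed
  with e have p: "0 < p"
    by simp
  define u where "u i = G i a / complex_of_real (sqrt p)" for i
  have sqrt_p: "complex_of_real (sqrt p) * complex_of_real (sqrt p) = complex_of_real p"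
    unfolding of_real_mult[symmetric] using p by simp
  have uu: "u i * cnj (u j) = G i a * cnj (G j a) / complex_of_real p" for i j
    unfolding u_def complex_cnj_divide complex_cnj_complex_of_real times_divide_times_eq sqrt_p ..
  define G' where "G' i j = G i j - u i * cnj (u j)" for i j
  have G'a: "G' i a = 0 \<and> G' a i = 0" if "i \<in> insert a I" for i
  proof -
    have "cnj (G i a) = G a i"
      using herm[of i a] that by simp
    then show ?thesis
      using p by (simp add: G'_def uu Gaa)
  qed
  have "0 \<le> Re (\<Sum>i\<in>I. \<Sum>j\<in>I. F i j * G' j i)"
  proof (rule insert.IH)
    show "0 \<le> Re (\<Sum>i\<in>I. \<Sum>j\<in>I. F i j * h j * cnj (h i))" for h
    proof -
      define h' where "h' i = (if i \<in> I then h i else 0)" for i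
      have "0 \<le> Re (\<Sum>i\<in>insert a I. \<Sum>j\<in>insert a I. F i j * h' j * cnj (h' i))"
        by (rule F)
      also have "(\<Sum>i\<in>insert a I. \<Sum>j\<in>insert a I. F i j * h' j * cnj (h' i)) =
        (\<Sum>i\<in>I. \<Sum>j\<in>I. F i j * h' j * cnj (h' i))"
        using insert.hyps by (intro supp) (simp add: h'_def)
      also have "\<dots> = (\<Sum>i\<in>I. \<Sum>j\<in>I. F i j * h j * cnj (h i))"
        by (intro sum.cong refl) (simp add: h'_def)
      finally show ?thesis .
    qed
    show "G' j i = cnj (G' i j)" if "i \<in> I" "j \<in> I" for i j
    proof -
      have "G j i = cnj (G i j)"
        using herm[of i j] that by simp
      then show ?thesis
        by (simp only: G'_def complex_cnj_diff complex_cnj_mult complex_cnj_cnj mult.commute)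
    qed
    show "e * (\<Sum>i\<in>I. (cmod (h i))\<^sup>2) \<le> Re (\<Sum>i\<in>I. \<Sum>j\<in>I. G' i j * h j * cnj (h i))" for h
    proof -
      \<comment> \<open>The value at \<open>a\<close> makes \<open>h'\<close> orthogonal to \<open>u\<close>, so that \<open>G\<close> and \<open>G'\<close> agree on \<open>h'\<close>.\<close>
      define h' where "h' i = (if i \<in> I then h i else - (\<Sum>j\<in>I. G a j * h j) / complex_of_real p)" for i
      have h'I: "(\<Sum>j\<in>I. G a j * h' j) = (\<Sum>j\<in>I. G a j * h j)"
        by (intro sum.cong refl) (simp add: h'_def)
      have "(\<Sum>j\<in>insert a I. cnj (u j) * h' j) = (\<Sum>j\<in>insert a I. G a j * h' j) / complex_of_real (sqrt p)"
        unfolding sum_divide_distrib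
      proof (rule sum.cong[OF refl])
        fix j assume "j \<in> insert a I"
        then have "cnj (G j a) = G a j"
          using herm[of j a] by simp
        then show "cnj (u j) * h' j = G a j * h' j / complex_of_real (sqrt p)"
          by (simp add: u_def)
      qed
      also have "(\<Sum>j\<in>insert a I. G a j * h' j) = 0"
        using insert.hyps p by (simp add: h'I Gaa) (simp add: h'_def)
      finally have orth: "(\<Sum>j\<in>insert a I. cnj (u j) * h' j) = 0"
        by simp
      have "(\<Sum>i\<in>insert a I. \<Sum>j\<in>insert a I. u i * cnj (u j) * h' j * cnj (h' i)) =
        (\<Sum>i\<in>insert a I. u i * cnj (h' i) * (\<Sum>j\<in>insert a I. cnj (u j) * h' j))"
        by (simp only: sum_distrib_left mult_ac)
      then have zero: "(\<Sum>i\<in>insert a I. \<Sum>j\<in>insert a I. u i * cnj (u j) * h' j * cnj (h' i)) = 0"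
        by (simp only: orth mult_zero_right sum.neutral_const)
      have "(\<Sum>i\<in>I. \<Sum>j\<in>I. G' i j * h j * cnj (h i)) = (\<Sum>i\<in>I. \<Sum>j\<in>I. G' i j * h' j * cnj (h' i))"
        by (intro sum.cong refl) (simp add: h'_def)
      also have "\<dots> = (\<Sum>i\<in>insert a I. \<Sum>j\<in>insert a I. G' i j * h' j * cnj (h' i))"
        by (rule supp[symmetric]) (simp add: G'a)
      also have "\<dots> = (\<Sum>i\<in>insert a I. \<Sum>j\<in>insert a I. G i j * h' j * cnj (h' i))
          - (\<Sum>i\<in>insert a I. \<Sum>j\<in>insert a I. u i * cnj (u j) * h' j * cnj (h' i))"
        by (simp only: G'_def left_diff_distrib sum_subtractf)
      finally have form: "(\<Sum>i\<in>I. \<Sum>j\<in>I. G' i j * h j * cnj (h i)) =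
          (\<Sum>i\<in>insert a I. \<Sum>j\<in>insert a I. G i j * h' j * cnj (h' i))"
        by (simp only: zero diff_zero)
      have "(\<Sum>i\<in>I. (cmod (h i))\<^sup>2) = (\<Sum>i\<in>I. (cmod (h' i))\<^sup>2)"
        by (intro sum.cong refl) (simp add: h'_def)
      also have "\<dots> \<le> (\<Sum>i\<in>insert a I. (cmod (h' i))\<^sup>2)"
        using insert.hyps by simp
      finally have "e * (\<Sum>i\<in>I. (cmod (h i))\<^sup>2) \<le> e * (\<Sum>i\<in>insert a I. (cmod (h' i))\<^sup>2)"
        using e by simp
      also have "\<dots> \<le> Re (\<Sum>i\<in>insert a I. \<Sum>j\<in>insert a I. G i j * h' j * cnj (h' i))"
        by (rule pos)
      finally show ?thesis
        by (simp only: form)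
    qed
  qed
  also have "(\<Sum>i\<in>I. \<Sum>j\<in>I. F i j * G' j i) = (\<Sum>i\<in>insert a I. \<Sum>j\<in>insert a I. F i j * G' j i)"
    by (rule supp[symmetric]) (simp add: G'a)
  finally have "0 \<le> Re (\<Sum>i\<in>insert a I. \<Sum>j\<in>insert a I. F i j * G' j i)" .
  moreover have "0 \<le> Re (\<Sum>i\<in>insert a I. \<Sum>j\<in>insert a I. F i j * u j * cnj (u i))"
    by (rule F)
  moreover have "(\<Sum>i\<in>insert a I. \<Sum>j\<in>insert a I. F i j * G j i) =
      (\<Sum>i\<in>insert a I. \<Sum>j\<in>insert a I. F i j * G' j i) +
      (\<Sum>i\<in>insert a I. \<Sum>j\<in>insert a I. F i j * u j * cnj (u i))"
    unfolding sum.distrib[symmetric] by (intro sum.cong refl) (simp add: G'_def algebra_simps)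
  ultimately show ?case
    by (simp only: plus_complex.sel)
qed

text \<open>Adding e times the identity to G makes it strictly positive and changes the sum by e
  times the trace of F; then e tends to 0.\<close>

lemma schur_product_nonneg:
  fixes F G :: "'i \<Rightarrow> 'i \<Rightarrow> complex"
  assumes I: "finite I"
    and F: "\<And>h. 0 \<le> Re (\<Sum>i\<in>I. \<Sum>j\<in>I. F i j * h j * cnj (h i))"
    and herm: "\<And>i j. i \<in> I \<Longrightarrow> j \<in> I \<Longrightarrow> G j i = cnj (G i j)"
    and pos: "\<And>h. 0 \<le> Re (\<Sum>i\<in>I. \<Sum>j\<in>I. G i j * h j * cnj (h i))"
  shows "0 \<le> Re (\<Sum>i\<in>I. \<Sum>j\<in>I. F i j * G j i)"
proof -
  define D where "D = Re (\<Sum>i\<in>I. F i i)"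
  have "0 \<le> Re (\<Sum>i\<in>I. \<Sum>j\<in>I. F i j * G j i) + e * D" if e: "0 < e" for e
  proof -
    let ?G = "\<lambda>i j. G i j + (if i = j then complex_of_real e else 0)"
    have form: "(\<Sum>i\<in>I. \<Sum>j\<in>I. ?G i j * h j * cnj (h i)) =
      (\<Sum>i\<in>I. \<Sum>j\<in>I. G i j * h j * cnj (h i)) + complex_of_real (e * (\<Sum>i\<in>I. (cmod (h i))\<^sup>2))" for h
    proof -
      have "?G i j * h j * cnj (h i) =
        G i j * h j * cnj (h i) + (if i = j then complex_of_real (e * (cmod (h i))\<^sup>2) else 0)" for i j
        by (cases "i = j")
          (simp_all only: simp_thms if_True if_False of_real_mult complex_norm_square distrib_right
            mult.assoc add_0_right)
      then show ?thesis
        by (simp add: sum.distrib I sum_distrib_left)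
    qed
    have "0 \<le> Re (\<Sum>i\<in>I. \<Sum>j\<in>I. F i j * ?G j i)"
    proof (rule schur_product_strict[OF I F _ _ e])
      show "?G j i = cnj (?G i j)" if "i \<in> I" "j \<in> I" for i j
        using herm[OF that] by auto
      show "e * (\<Sum>i\<in>I. (cmod (h i))\<^sup>2) \<le> Re (\<Sum>i\<in>I. \<Sum>j\<in>I. ?G i j * h j * cnj (h i))" for h
        using pos[of h] unfolding form by simp
    qed
    also have "(\<Sum>i\<in>I. \<Sum>j\<in>I. F i j * ?G j i) =
      (\<Sum>i\<in>I. \<Sum>j\<in>I. F i j * G j i) + complex_of_real e * (\<Sum>i\<in>I. F i i)"
    proof -
      have "F i j * ?G j i = F i j * G j i + (if i = j then complex_of_real e * F i i else 0)" for i j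
        by (simp add: distrib_left)
      then show ?thesis
        by (simp add: sum.distrib I sum_distrib_left)
    qed
    finally show ?thesis
      by (simp add: D_def)
  qed
  then have "\<forall>\<^sub>F e in at_right 0. 0 \<le> Re (\<Sum>i\<in>I. \<Sum>j\<in>I. F i j * G j i) + e * D"
    by (simp add: eventually_at_filter)
  moreover have "((\<lambda>e. Re (\<Sum>i\<in>I. \<Sum>j\<in>I. F i j * G j i) + e * D)
      \<longlongrightarrow> Re (\<Sum>i\<in>I. \<Sum>j\<in>I. F i j * G j i) + 0 * D) (at_right 0)"
    by (intro tendsto_intros)
  ultimately have "0 \<le> Re (\<Sum>i\<in>I. \<Sum>j\<in>I. F i j * G j i) + 0 * D"
    by (intro tendsto_lowerbound[of _ _ "at_right (0::real)"]) simp_all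
  then show ?thesis
    by simp
qed

section \<open>Gram matrices and orthonormal systems\<close>

lemma gram_form:
  fixes x y :: "'i \<Rightarrow> 'a::chilbert"
  shows "(\<Sum>i\<in>I. \<Sum>j\<in>I. cinner (x i) (y j) * h j * cnj (h i)) =
    cinner (\<Sum>i\<in>I. cnj (h i) *\<^sub>C x i) (\<Sum>j\<in>I. cnj (h j) *\<^sub>C y j)"
  unfolding cinner_sum_left
  by (simp only: cinner_sum_right cinner_scaleC_left cinner_scaleC_right sum_distrib_left
      complex_cnj_cnj mult_ac)

text \<open>Complex Cauchy-Schwarz from the real one: multiplying x by a phase makes the inner
  product real and nonnegative.\<close>

lemma norm_cinner_le: "cmod (cinner x y) \<le> norm x * norm (y::'a::chilbert)"
proof (cases "cinner x y = 0")
  case False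
  define c where "c = cnj (cinner x y) / complex_of_real (cmod (cinner x y))"
  have c: "cmod c = 1"
    using False by (simp add: c_def norm_divide)
  have "cinner (c *\<^sub>C x) y = complex_of_real (cmod (cinner x y))"
  proof -
    have "cinner (c *\<^sub>C x) y = cinner x y * cnj (cinner x y) / complex_of_real (cmod (cinner x y))"
      by (simp add: cinner_scaleC_left c_def mult.commute)
    also have "\<dots> = complex_of_real (cmod (cinner x y))"
      unfolding complex_norm_square[symmetric] power2_eq_square of_real_mult using False by simp
    finally show ?thesis .
  qed
  then have "cmod (cinner x y) = inner (c *\<^sub>C x) y"
    by (simp add: inner_eq_Re_cinner)
  also have "\<dots> \<le> norm (c *\<^sub>C x) * norm y"
    by (rule norm_cauchy_schwarz)
  finally show ?thesis
    by (simp add: norm_scaleC c)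
qed simp

text \<open>Gram-Schmidt: the span of n vectors is never the whole space, so a vector outside it
  leaves a nonzero residue to normalise.\<close>

lemma exists_orthonormal_nat:
  assumes "infinite_cdim TYPE('k::chilbert)"
  shows "\<exists>e :: nat \<Rightarrow> 'k. \<forall>i<n. \<forall>j<n. cinner (e i) (e j) = (if i = j then 1 else 0)"
proof (induction n)
  case (Suc n)
  then obtain e :: "nat \<Rightarrow> 'k" where
    "\<forall>i<n. \<forall>j<n. cinner (e i) (e j) = (if i = j then 1 else 0)" ..
  then have e: "cinner (e i) (e j) = (if i = j then 1 else 0)" if "i < n" "j < n" for i j
    using that by simp
  interpret C: Modules.module "scaleC :: complex \<Rightarrow> 'k \<Rightarrow> 'k"
    by unfold_locales (simp_all add: scaleC_add_right scaleC_add_left scaleC_scaleC)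
  have "C.span (e ` {..<n}) \<noteq> UNIV"
    using assms unfolding infinite_cdim_def by blast
  then obtain v where v: "v \<notin> C.span (e ` {..<n})"
    by blast
  define w where "w = v - (\<Sum>i<n. cinner v (e i) *\<^sub>C e i)"
  have "(\<Sum>i<n. cinner v (e i) *\<^sub>C e i) \<in> C.span (e ` {..<n})"
    by (intro C.span_sum C.span_scale C.span_base) auto
  with v have w: "w \<noteq> 0"
    by (auto simp: w_def)
  have w_e: "cinner w (e j) = 0" if "j < n" for j
  proof -
    have "(\<Sum>i<n. cinner v (e i) * cinner (e i) (e j)) = (\<Sum>i<n. if i = j then cinner v (e j) else 0)"
      by (intro sum.cong refl) (auto simp: e that)
    then show ?thesis
      using that by (simp add: w_def cinner_diff_left cinner_sum_left cinner_scaleC_left)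
  qed
  have ww: "cinner w w = complex_of_real (norm w) * complex_of_real (norm w)"
    by (simp add: cinner_self power2_eq_square)
  define e' where "e' = e(n := complex_of_real (1 / norm w) *\<^sub>C w)"
  have "cinner (e' i) (e' j) = (if i = j then 1 else 0)" if "i < Suc n" "j < Suc n" for i j
  proof -
    have "cinner (e j) w = 0" if "j < n" for j
      using w_e[OF that] by (subst cinner_commute) simp
    then show ?thesis
      using that w ww by (auto simp: e'_def less_Suc_eq e w_e cinner_scaleC_left cinner_scaleC_right)
  qed
  then show ?case
    by (intro exI[of _ e']) simp
qed simp

lemma exists_orthonormal:
  assumes K: "infinite_cdim TYPE('k::chilbert)" and W: "finite W"
  shows "\<exists>e :: 'w \<Rightarrow> 'k. \<forall>u\<in>W. \<forall>v\<in>W. cinner (e u) (e v) = (if u = v then 1 else 0)"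
proof -
  obtain f :: "'w \<Rightarrow> nat" and n where f: "f ` W = {i. i < n}" "inj_on f W"
    using finite_imp_inj_to_nat_seg[OF W] by blast
  obtain e :: "nat \<Rightarrow> 'k" where
    e: "\<forall>i<n. \<forall>j<n. cinner (e i) (e j) = (if i = j then 1 else 0)"
    using exists_orthonormal_nat[OF K, of n] ..
  have "cinner (e (f u)) (e (f v)) = (if u = v then 1 else 0)" if "u \<in> W" "v \<in> W" for u v
  proof -
    have "f u < n" "f v < n"
      using f(1) that by blast+
    then show ?thesis
      by (simp add: e inj_on_eq_iff[OF f(2) that])
  qed
  then show ?thesis
    by (intro exI[of _ "\<lambda>u. e (f u)"] ballI)
qed

lemma norm_orthonormal_sum:
  fixes e :: "'w \<Rightarrow> 'k::chilbert"
  assumes W: "finite W"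
    and e: "\<And>u v. u \<in> W \<Longrightarrow> v \<in> W \<Longrightarrow> cinner (e u) (e v) = (if u = v then 1 else 0)"
  shows "(norm (\<Sum>u\<in>W. c u *\<^sub>C e u))\<^sup>2 = (\<Sum>u\<in>W. (cmod (c u))\<^sup>2)"
proof -
  have "complex_of_real ((norm (\<Sum>u\<in>W. c u *\<^sub>C e u))\<^sup>2) =
      (\<Sum>u\<in>W. \<Sum>v\<in>W. c u * (cnj (c v) * cinner (e u) (e v)))"
    unfolding cinner_self[symmetric] cinner_sum_left
    by (simp only: cinner_sum_right cinner_scaleC_left cinner_scaleC_right sum_distrib_left)
      (simp only: mult_ac)
  also have "\<dots> = (\<Sum>u\<in>W. \<Sum>v\<in>W. if u = v then c u * cnj (c u) else 0)"
    by (intro sum.cong refl) (auto simp: e)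
  also have "\<dots> = (\<Sum>u\<in>W. c u * cnj (c u))"
    using W by simp
  also have "\<dots> = complex_of_real (\<Sum>u\<in>W. (cmod (c u))\<^sup>2)"
    by (simp only: of_real_sum complex_norm_square)
  finally show ?thesis
    by (simp only: of_real_eq_iff)
qed

lemma bessel_inequality:
  fixes e :: "'w \<Rightarrow> 'k::chilbert"
  assumes W: "finite W"
    and e: "\<And>u v. u \<in> W \<Longrightarrow> v \<in> W \<Longrightarrow> cinner (e u) (e v) = (if u = v then 1 else 0)"
  shows "(\<Sum>u\<in>W. (cmod (cinner y (e u)))\<^sup>2) \<le> (norm y)\<^sup>2"
proof -
  let ?z = "\<Sum>u\<in>W. cinner y (e u) *\<^sub>C e u"
  have z: "(norm ?z)\<^sup>2 = (\<Sum>u\<in>W. (cmod (cinner y (e u)))\<^sup>2)"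
    by (rule norm_orthonormal_sum[OF W e])
  have "cinner y ?z = complex_of_real (\<Sum>u\<in>W. (cmod (cinner y (e u)))\<^sup>2)"
    by (simp only: cinner_sum_right cinner_scaleC_right of_real_sum complex_norm_square mult.commute)
  then have yz: "inner y ?z = (norm ?z)\<^sup>2"
    by (simp add: inner_eq_Re_cinner z)
  have "0 \<le> (norm (y - ?z))\<^sup>2"
    by simp
  also have "\<dots> = (norm y)\<^sup>2 - 2 * inner y ?z + (norm ?z)\<^sup>2"
    by (simp add: power2_norm_eq_inner inner_diff_left inner_diff_right inner_commute)
  finally show ?thesis
    by (simp add: yz z)
qed

lemma bounded_linear_cinner_scaleC:
  fixes u :: "'a::chilbert" and v :: "'b::chilbert"
  shows "bounded_linear (\<lambda>y. cinner y u *\<^sub>C v)"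
proof (rule bounded_linear_intro)
  show "norm (cinner y u *\<^sub>C v) \<le> norm y * (norm u * norm v)" for y
    using mult_right_mono[OF norm_cinner_le[of y u], of "norm v"]
    by (simp add: norm_scaleC mult.assoc)
qed (simp_all add: cinner_add_left scaleC_add_left scaleR_scaleC cinner_scaleC_left scaleC_scaleC)

section \<open>Truncated creation operators\<close>

text \<open>When e is orthonormal on the words of length at most N, this is r times the left
  creation operator on that truncated Fock space: it sends e_\<gamma> to r e_(i\<gamma>), kills the
  words of full length N and the orthogonal complement.\<close>

definition creation ::
    "real \<Rightarrow> nat \<Rightarrow> ('n::finite list \<Rightarrow> 'k::chilbert) \<Rightarrow> 'n \<Rightarrow> 'k \<Rightarrow>\<^sub>L 'k" where
  "creation r N e i =
     Blinfun (\<lambda>y. \<Sum>\<gamma> | length \<gamma> < N. cinner y (complex_of_real r *\<^sub>C e \<gamma>) *\<^sub>C e (i # \<gamma>))"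

context
  fixes r :: real and N :: nat and e :: "'n::finite list \<Rightarrow> 'k::chilbert"
  assumes r: "0 < r" "r < 1"
    and e: "\<And>u v. length u \<le> N \<Longrightarrow> length v \<le> N \<Longrightarrow> cinner (e u) (e v) = (if u = v then 1 else 0)"
begin

lemma finite_words_less: "finite {\<alpha> :: 'n list. length \<alpha> < N}"
  by (rule finite_subset[OF _ finite_words_le[of N]]) auto

lemma creation_apply:
  "blinfun_apply (creation r N e i) y =
    (\<Sum>\<gamma> | length \<gamma> < N. (complex_of_real r * cinner y (e \<gamma>)) *\<^sub>C e (i # \<gamma>))"
proof -
  have "bounded_linear
    (\<lambda>y. \<Sum>\<gamma> | length \<gamma> < N. cinner y (complex_of_real r *\<^sub>C e \<gamma>) *\<^sub>C e (i # \<gamma>))"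
    by (intro bounded_linear_sum bounded_linear_cinner_scaleC)
  then show ?thesis
    by (simp add: creation_def bounded_linear_Blinfun_apply cinner_scaleC_right)
qed

lemma creation_bop: "creation r N e i \<in> bop"
  by (simp add: bop_def creation_apply cinner_scaleC_left scaleC_sum_right scaleC_scaleC mult_ac)

lemma creation_adj_apply:
  "blinfun_apply (op_adj (creation r N e i)) y =
    (\<Sum>\<gamma> | length \<gamma> < N. (complex_of_real r * cinner y (e (i # \<gamma>))) *\<^sub>C e \<gamma>)"
proof (rule cinner_ext)
  fix z
  have "cinner z (blinfun_apply (op_adj (creation r N e i)) y) =
      (\<Sum>\<gamma> | length \<gamma> < N. complex_of_real r * cinner z (e \<gamma>) * cinner (e (i # \<gamma>)) y)"
    by (simp add: op_adj[OF creation_bop, symmetric] creation_apply cinner_sum_left cinner_scaleC_left)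
  also have "\<dots> = (\<Sum>\<gamma> | length \<gamma> < N. cinner z ((complex_of_real r * cinner y (e (i # \<gamma>))) *\<^sub>C e \<gamma>))"
  proof (rule sum.cong[OF refl])
    fix \<gamma>
    show "complex_of_real r * cinner z (e \<gamma>) * cinner (e (i # \<gamma>)) y =
        cinner z ((complex_of_real r * cinner y (e (i # \<gamma>))) *\<^sub>C e \<gamma>)"
      by (subst cinner_commute[of _ y]) (simp add: cinner_scaleC_right)
  qed
  finally show "cinner z (blinfun_apply (op_adj (creation r N e i)) y) =
      cinner z (\<Sum>\<gamma> | length \<gamma> < N. (complex_of_real r * cinner y (e (i # \<gamma>))) *\<^sub>C e \<gamma>)"
    by (simp only: cinner_sum_right)
qed

text \<open>The adjoints read off coefficients along the vectors e_(i\<gamma>), which are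
  orthonormal over all pairs (i, \<gamma>). Bessel's inequality bounds the row by r^2 < 1.\<close>

lemma creation_open_row_ball: "creation r N e \<in> open_row_ball"
proof -
  let ?S = "(UNIV :: 'n set) \<times> {\<gamma> :: 'n list. length \<gamma> < N}"
  have fin: "finite ?S"
    by (intro finite_cartesian_product finite_words_less) simp
  have "norm (\<Sum>i\<in>UNIV. creation r N e i o\<^sub>L op_adj (creation r N e i)) \<le> r\<^sup>2"
  proof (rule norm_row_op_le)
    fix y
    have "(\<Sum>i\<in>UNIV. (norm (blinfun_apply (op_adj (creation r N e i)) y))\<^sup>2) =
        (\<Sum>i\<in>UNIV. \<Sum>\<gamma> | length \<gamma> < N. r\<^sup>2 * (cmod (cinner y (e (i # \<gamma>))))\<^sup>2)"
      unfolding creation_adj_apply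
      by (subst norm_orthonormal_sum[OF finite_words_less])
        (simp_all add: e norm_mult power_mult_distrib)
    also have "\<dots> = r\<^sup>2 * (\<Sum>u\<in>?S. (cmod (cinner y (e (fst u # snd u))))\<^sup>2)"
      by (simp add: sum_distrib_left[symmetric] sum.cartesian_product case_prod_beta)
    also have "\<dots> \<le> r\<^sup>2 * (norm y)\<^sup>2"
    proof (intro mult_left_mono bessel_inequality fin)
      fix u v assume "u \<in> ?S" "v \<in> ?S"
      then show "cinner (e (fst u # snd u)) (e (fst v # snd v)) = (if u = v then 1 else 0)"
        by (auto simp: e prod_eq_iff)
    qed simp
    finally show "(\<Sum>i\<in>UNIV. (norm (blinfun_apply (op_adj (creation r N e i)) y))\<^sup>2) \<le> r\<^sup>2 * (norm y)\<^sup>2" .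
  qed (simp_all add: creation_bop)
  also have "\<dots> < 1"
    using r by (simp add: power_less_one_iff)
  finally show ?thesis
    by (simp add: open_row_ball_def creation_bop)
qed

lemma creation_basis:
  assumes "length \<delta> \<le> N"
  shows "blinfun_apply (creation r N e i) (e \<delta>) =
    (if length \<delta> < N then complex_of_real r *\<^sub>C e (i # \<delta>) else 0)"
proof -
  have "blinfun_apply (creation r N e i) (e \<delta>) =
      (\<Sum>\<gamma> | length \<gamma> < N. if \<gamma> = \<delta> then complex_of_real r *\<^sub>C e (i # \<delta>) else 0)"
    unfolding creation_apply using assms by (intro sum.cong refl) (simp add: e)
  then show ?thesis
    by (simp add: sum.delta[OF finite_words_less])
qed

lemma word_creation_basis:
  assumes "length \<delta> \<le> N"
  shows "blinfun_apply (word_op (creation r N e) \<alpha>) (e \<delta>) =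
    (if length \<alpha> + length \<delta> \<le> N then complex_of_real (r ^ length \<alpha>) *\<^sub>C e (\<alpha> @ \<delta>) else 0)"
proof (induction \<alpha>)
  case (Cons i \<alpha>)
  then show ?case
    by (simp add: bop_scaleC[OF creation_bop] creation_basis scaleC_scaleC mult.commute)
qed (use assms in simp)

lemma cinner_word_creation:
  assumes "length \<delta> \<le> N" "length \<gamma> \<le> N"
  shows "cinner (blinfun_apply (word_op (creation r N e) \<alpha>) (e \<delta>)) (e \<gamma>) =
    (if \<gamma> = \<alpha> @ \<delta> then complex_of_real (r ^ length \<alpha>) else 0)"
  using assms by (auto simp: word_creation_basis cinner_scaleC_left e)

end

section \<open>Coefficient forms and the estimate of homogeneous parts\<close>

text \<open>The sesquilinear form of the identity tensor M on the m-fold sum of the space. Two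
  separate vectors allow an operator to be moved from one side to the other.\<close>

definition coeff_form :: "nat \<Rightarrow> complex mat \<Rightarrow> (nat \<Rightarrow> 'a::chilbert) \<Rightarrow> (nat \<Rightarrow> 'a) \<Rightarrow> complex" where
  "coeff_form m M x y = (\<Sum>i<m. \<Sum>j<m. M $$ (i, j) * cinner (x j) (y i))"

text \<open>The words other than \<open>[]\<close> and those of length \<open>k\<close> drop out of the compression of
  \<open>Re p(X)\<close> to the corresponding basis vectors, which isolates the homogeneous part of
  degree \<open>k\<close>.\<close>

lemma homogeneous_part_pos:
  fixes p :: "'n::finite list \<Rightarrow> complex mat" and y :: "'n list \<Rightarrow> nat \<Rightarrow> 'h::chilbert"
  assumes K: "infinite_cdim TYPE('k::chilbert)" and p: "p \<in> nc_polys m"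
    and pos: "\<And>(X :: 'n \<Rightarrow> 'k \<Rightarrow>\<^sub>L 'k) x. X \<in> open_row_ball \<Longrightarrow> 0 \<le> Re (poly_form m p X x)"
    and k: "1 \<le> k" and r: "0 < r" "r < 1"
  shows "0 \<le> Re (coeff_form m (p []) (y []) (y [])) + (\<Sum>\<alpha> | length \<alpha> = k. Re (coeff_form m (p []) (y \<alpha>) (y \<alpha>)))
    + r ^ k * (\<Sum>\<alpha> | length \<alpha> = k. Re (coeff_form m (p \<alpha>) (y []) (y \<alpha>)))"
proof -
  define W where "W = insert [] {\<alpha> :: 'n list. length \<alpha> = k}"
  have W: "finite W"
    by (simp add: W_def finite_words_eq)
  have W_le: "length w \<le> k" if "w \<in> W" for w
    using that by (auto simp: W_def)
  obtain e :: "'n list \<Rightarrow> 'k" where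
    "\<forall>u\<in>{w. length w \<le> k}. \<forall>v\<in>{w. length w \<le> k}. cinner (e u) (e v) = (if u = v then 1 else 0)"
    using exists_orthonormal[OF K finite_words_le[of k, where ?'n = 'n]] ..
  then have e: "cinner (e u) (e v) = (if u = v then 1 else 0)"
    if "length u \<le> k" "length v \<le> k" for u v
    using that by simp
  let ?X = "creation r k e"
  define S where "S = {\<alpha>. p \<alpha> \<noteq> 0\<^sub>m m m} \<union> W"
  have S: "finite S" "{\<alpha>. p \<alpha> \<noteq> 0\<^sub>m m m} \<subseteq> S" "W \<subseteq> S"
    using p W by (auto simp: S_def nc_polys_def)
  \<comment> \<open>The compression of p(X) as a scalar matrix indexed by (word, row): p_[] on the
    diagonal blocks, r^k p_v in the column of the empty word. It need not be Hermitian; only the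
    real part of its form is controlled.\<close>
  define F where "F a b = (if fst a = fst b then p [] $$ (snd a, snd b)
      else if fst b = [] then complex_of_real (r ^ k) * p (fst a) $$ (snd a, snd b) else 0)"
    for a b :: "'n list \<times> nat"
  let ?I = "W \<times> {..<m}"
  have compress: "(\<Sum>\<alpha>\<in>S. p \<alpha> $$ (i, j) * cinner (blinfun_apply (word_op ?X \<alpha>) (e w)) (e v)) = F (v, i) (w, j)"
    if v: "v \<in> W" and w: "w \<in> W" for v w i j
  proof -
    have "(\<Sum>\<alpha>\<in>S. p \<alpha> $$ (i, j) * cinner (blinfun_apply (word_op ?X \<alpha>) (e w)) (e v)) =
        (\<Sum>\<alpha>\<in>S. if v = \<alpha> @ w then p \<alpha> $$ (i, j) * complex_of_real (r ^ length \<alpha>) else 0)"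
      by (intro sum.cong refl) (simp add: cinner_word_creation[OF r e] W_le v w)
    also have "\<dots> = F (v, i) (w, j)"
    proof (cases "v = w")
      case True
      then have "v = \<alpha> @ w \<longleftrightarrow> \<alpha> = []" for \<alpha>
        by auto
      moreover have "[] \<in> S"
        using S by (auto simp: W_def)
      ultimately show ?thesis
        using S True by (simp add: F_def)
    next
      case False
      show ?thesis
      proof (cases "w = []")
        case True
        have "length v = k" "v \<in> S"
          using v False True S by (auto simp: W_def)
        then show ?thesis
          using S False True by (simp add: F_def mult.commute)
      next
        case w': False
        then have "length w = k" "length v \<le> k"
          using w v by (auto simp: W_def)
        \<comment> \<open>As w already has the maximal length k, v = \<alpha> w would force \<alpha>
          = [] and v = w.\<close>
        with False have "v \<noteq> \<alpha> @ w" for \<alpha>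
          by auto
        then show ?thesis
          using False w' by (simp add: F_def)
      qed
    qed
    finally show ?thesis .
  qed
  have F_form: "(\<Sum>a\<in>?I. \<Sum>b\<in>?I. F a b * H b a) =
      (\<Sum>v\<in>W. \<Sum>i<m. \<Sum>w\<in>W. \<Sum>j<m. F (v, i) (w, j) * H (w, j) (v, i))" for H
    by (simp only: sum.cartesian_product')
  have F_pos: "0 \<le> Re (\<Sum>a\<in>?I. \<Sum>b\<in>?I. F a b * h b * cnj (h a))" for h
  proof -
    define x where "x i = (\<Sum>w\<in>W. h (w, i) *\<^sub>C e w)" for i
    let ?c = "\<lambda>\<alpha> w v. cinner (blinfun_apply (word_op ?X \<alpha>) (e w)) (e v)"
    have "poly_form m p ?X x = (\<Sum>\<alpha>\<in>S. \<Sum>i<m. \<Sum>j<m.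
        p \<alpha> $$ (i, j) * cinner (blinfun_apply (word_op ?X \<alpha>) (x j)) (x i))"
      by (rule poly_form_superset[OF S(1,2)])
    also have "\<dots> = (\<Sum>\<alpha>\<in>S. \<Sum>i<m. \<Sum>j<m. \<Sum>v\<in>W. \<Sum>w\<in>W.
        p \<alpha> $$ (i, j) * ?c \<alpha> w v * (h (w, j) * cnj (h (v, i))))"
    proof (intro sum.cong refl)
      fix \<alpha> i j
      have "cinner (blinfun_apply (word_op ?X \<alpha>) (x j)) (x i) =
          (\<Sum>v\<in>W. \<Sum>w\<in>W. cnj (h (v, i)) * (h (w, j) * ?c \<alpha> w v))"
        by (simp add: x_def blinfun.sum_right bop_scaleC[OF word_op_bop[OF creation_bop[OF r e]]]
            cinner_sum_left cinner_sum_right cinner_scaleC_left cinner_scaleC_right sum_distrib_left)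
      then show "p \<alpha> $$ (i, j) * cinner (blinfun_apply (word_op ?X \<alpha>) (x j)) (x i) =
          (\<Sum>v\<in>W. \<Sum>w\<in>W. p \<alpha> $$ (i, j) * ?c \<alpha> w v * (h (w, j) * cnj (h (v, i))))"
        by (simp add: sum_distrib_left mult_ac)
    qed
    also have "\<dots> = (\<Sum>i<m. \<Sum>j<m. \<Sum>v\<in>W. \<Sum>w\<in>W. \<Sum>\<alpha>\<in>S.
        p \<alpha> $$ (i, j) * ?c \<alpha> w v * (h (w, j) * cnj (h (v, i))))"
      by (simp only: sum.swap[of _ _ S])
    also have "\<dots> = (\<Sum>i<m. \<Sum>j<m. \<Sum>v\<in>W. \<Sum>w\<in>W. F (v, i) (w, j) * (h (w, j) * cnj (h (v, i))))"
      by (intro sum.cong refl) (simp add: sum_distrib_right[symmetric] compress)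
    also have "\<dots> = (\<Sum>i<m. \<Sum>v\<in>W. \<Sum>j<m. \<Sum>w\<in>W. F (v, i) (w, j) * (h (w, j) * cnj (h (v, i))))"
      by (intro sum.cong refl sum.swap)
    also have "\<dots> = (\<Sum>v\<in>W. \<Sum>i<m. \<Sum>j<m. \<Sum>w\<in>W. F (v, i) (w, j) * (h (w, j) * cnj (h (v, i))))"
      by (rule sum.swap)
    also have "\<dots> = (\<Sum>v\<in>W. \<Sum>i<m. \<Sum>w\<in>W. \<Sum>j<m. F (v, i) (w, j) * (h (w, j) * cnj (h (v, i))))"
      by (intro sum.cong refl sum.swap)
    also have "\<dots> = (\<Sum>a\<in>?I. \<Sum>b\<in>?I. F a b * (h b * cnj (h a)))"
      by (rule F_form[symmetric])
    finally have "poly_form m p ?X x = (\<Sum>a\<in>?I. \<Sum>b\<in>?I. F a b * h b * cnj (h a))"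
      by (simp only: mult.assoc)
    moreover have "?X \<in> open_row_ball"
      by (rule creation_open_row_ball[OF r]) (rule e)
    ultimately show ?thesis
      using pos[of ?X x] by simp
  qed
  let ?y = "\<lambda>a. y (fst a) (snd a)"
  \<comment> \<open>Passage from K to H: the scalars h b times the conjugate of h a are replaced by
    the Gram matrix of the vectors y.\<close>
  have "0 \<le> Re (\<Sum>a\<in>?I. \<Sum>b\<in>?I. F a b * cinner (?y b) (?y a))"
  proof (rule schur_product_nonneg[where G = "\<lambda>a b. cinner (?y a) (?y b)"])
    show "0 \<le> Re (\<Sum>a\<in>?I. \<Sum>b\<in>?I. cinner (?y a) (?y b) * h b * cnj (h a))" for h
      unfolding gram_form by (simp add: cinner_self)
    show "cinner (?y b) (?y a) = cnj (cinner (?y a) (?y b))" for a b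
      by (rule cinner_commute)
  qed (use W F_pos in auto)
  also have "(\<Sum>a\<in>?I. \<Sum>b\<in>?I. F a b * cinner (?y b) (?y a)) =
      (\<Sum>v\<in>W. \<Sum>i<m. \<Sum>w\<in>W. \<Sum>j<m. F (v, i) (w, j) * cinner (y w j) (y v i))"
    by (simp add: F_form)
  also have "\<dots> = (\<Sum>v\<in>W. \<Sum>w\<in>W. \<Sum>i<m. \<Sum>j<m. F (v, i) (w, j) * cinner (y w j) (y v i))"
    by (intro sum.cong refl sum.swap)
  also have "\<dots> = (\<Sum>v\<in>W. coeff_form m (p []) (y v) (y v)
      + (if v = [] then 0 else complex_of_real (r ^ k) * coeff_form m (p v) (y []) (y v)))"
  proof (rule sum.cong[OF refl])
    fix v assume v: "v \<in> W"
    let ?t = "\<lambda>w. \<Sum>i<m. \<Sum>j<m. F (v, i) (w, j) * cinner (y w j) (y v i)"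
    have "?t w = (if w = v then coeff_form m (p []) (y v) (y v) else 0) +
        (if w = [] then if v = [] then 0 else complex_of_real (r ^ k) * coeff_form m (p v) (y []) (y v) else 0)" for w
      by (auto simp: F_def coeff_form_def sum_distrib_left mult.assoc)
    then show "(\<Sum>w\<in>W. ?t w) = coeff_form m (p []) (y v) (y v)
        + (if v = [] then 0 else complex_of_real (r ^ k) * coeff_form m (p v) (y []) (y v))"
      using v W by (simp add: sum.distrib) (simp add: W_def)
  qed
  also have "\<dots> = coeff_form m (p []) (y []) (y []) + (\<Sum>v | length v = k.
      coeff_form m (p []) (y v) (y v) + complex_of_real (r ^ k) * coeff_form m (p v) (y []) (y v))"
    unfolding W_def using k by (subst sum.insert[OF finite_words_eq]) (auto intro!: sum.cong)
  finally show ?thesis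
    by (simp add: sum.distrib sum_distrib_left)
qed

lemma coeff_form_scale:
  "coeff_form m M (\<lambda>i. c *\<^sub>C x i) (\<lambda>i. d *\<^sub>C y i) = c * cnj d * coeff_form m M x y"
  by (simp add: coeff_form_def cinner_scaleC_left cinner_scaleC_right sum_distrib_left mult_ac)

text \<open>The zero tuple lies in the open ball; testing there on multiples of one unit vector
  leaves the scalar form of p_[].\<close>

lemma constant_coeff_scalar_nonneg:
  fixes p :: "'n::finite list \<Rightarrow> complex mat"
  assumes K: "infinite_cdim TYPE('k::chilbert)" and p: "p \<in> nc_polys m"
    and pos: "\<And>(X :: 'n \<Rightarrow> 'k \<Rightarrow>\<^sub>L 'k) x. X \<in> open_row_ball \<Longrightarrow> 0 \<le> Re (poly_form m p X x)"
  shows "0 \<le> Re (\<Sum>i<m. \<Sum>j<m. p [] $$ (i, j) * h j * cnj (h i))"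
proof -
  obtain e :: "nat \<Rightarrow> 'k" where "\<forall>i<1. \<forall>j<1. cinner (e i) (e j) = (if i = j then 1 else 0)"
    using exists_orthonormal_nat[OF K, of 1] ..
  then have e: "cinner (e 0) (e 0) = 1"
    by simp
  have "(\<lambda>_. 0) \<in> (open_row_ball :: ('n \<Rightarrow> 'k \<Rightarrow>\<^sub>L 'k) set)"
    by (simp add: open_row_ball_def bop_zero)
  from pos[OF this, of "\<lambda>i. h i *\<^sub>C e 0"] show ?thesis
    by (simp only: poly_form_zero[OF p] cinner_scaleC_left cinner_scaleC_right e mult_1_left mult_1_right mult_ac)
qed

lemma coeff_form_nonneg:
  assumes "\<And>h. 0 \<le> Re (\<Sum>i<m. \<Sum>j<m. M $$ (i, j) * h j * cnj (h i))"
  shows "0 \<le> Re (coeff_form m M x x)"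
  unfolding coeff_form_def
proof (rule schur_product_nonneg[where G = "\<lambda>i j. cinner (x i) (x j)"])
  show "0 \<le> Re (\<Sum>i<m. \<Sum>j<m. cinner (x i) (x j) * h j * cnj (h i))" for h
    unfolding gram_form by (simp add: cinner_self)
  show "cinner (x j) (x i) = cnj (cinner (x i) (x j))" for i j
    by (rule cinner_commute)
qed (use assms in auto)

text \<open>The operator a I minus the sum of the A_\<alpha> A_\<alpha>^* over words of length k is
  positive by the row norm bound. The Schur product of M with its kernel on the vectors x is the
  difference of the two sides.\<close>

lemma coeff_form_row_le:
  fixes A :: "'n::finite \<Rightarrow> 'h::chilbert \<Rightarrow>\<^sub>L 'h"
  assumes M: "\<And>h. 0 \<le> Re (\<Sum>i<m. \<Sum>j<m. M $$ (i, j) * h j * cnj (h i))"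
    and A: "\<And>i. A i \<in> bop" and a: "row_norm A k \<le> a"
  defines "B \<equiv> \<lambda>\<alpha>. blinfun_apply (op_adj (word_op A \<alpha>))"
  shows "(\<Sum>\<alpha> | length \<alpha> = k. Re (coeff_form m M (\<lambda>i. B \<alpha> (x i)) (\<lambda>i. B \<alpha> (x i))))
    \<le> a * Re (coeff_form m M x x)"
proof -
  let ?W = "{\<alpha> :: 'n list. length \<alpha> = k}"
  define G where "G u v = complex_of_real a * cinner u v - (\<Sum>\<alpha>\<in>?W. cinner (B \<alpha> u) (B \<alpha> v))" for u v
  have B_sum: "B \<alpha> (\<Sum>i<m. cnj (h i) *\<^sub>C x i) = (\<Sum>i<m. cnj (h i) *\<^sub>C B \<alpha> (x i))" for \<alpha> h
    by (simp add: B_def blinfun.sum_right bop_scaleC op_adj_in_bop word_op_bop A)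
  have G_self: "0 \<le> Re (G u u)" for u
  proof -
    have "row_sum A k u \<le> row_norm A k * (norm u)\<^sup>2"
      by (rule row_sum_le[OF A])
    also have "\<dots> \<le> a * (norm u)\<^sup>2"
      using a by (intro mult_right_mono) auto
    finally show ?thesis
      by (simp add: G_def B_def cinner_self row_sum_def)
  qed
  have "0 \<le> Re (\<Sum>i<m. \<Sum>j<m. M $$ (i, j) * G (x j) (x i))"
  proof (rule schur_product_nonneg[where G = "\<lambda>i j. G (x i) (x j)"])
    show "G (x j) (x i) = cnj (G (x i) (x j))" for i j
      by (simp add: G_def cinner_commute[symmetric])
    fix h :: "nat \<Rightarrow> complex"
    let ?u = "\<Sum>i<m. cnj (h i) *\<^sub>C x i"
    have "(\<Sum>i<m. \<Sum>j<m. G (x i) (x j) * h j * cnj (h i)) =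
      complex_of_real a * (\<Sum>i<m. \<Sum>j<m. cinner (x i) (x j) * h j * cnj (h i))
      - (\<Sum>\<alpha>\<in>?W. \<Sum>i<m. \<Sum>j<m. cinner (B \<alpha> (x i)) (B \<alpha> (x j)) * h j * cnj (h i))"
    proof -
      have "(\<Sum>i<m. \<Sum>j<m. \<Sum>\<alpha>\<in>?W. cinner (B \<alpha> (x i)) (B \<alpha> (x j)) * h j * cnj (h i)) =
        (\<Sum>\<alpha>\<in>?W. \<Sum>i<m. \<Sum>j<m. cinner (B \<alpha> (x i)) (B \<alpha> (x j)) * h j * cnj (h i))"
        by (simp only: sum.swap[of _ _ ?W])
      then show ?thesis
        by (simp add: G_def left_diff_distrib sum_subtractf sum_distrib_left sum_distrib_right mult.assoc)
    qed
    also have "\<dots> = G ?u ?u"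
      by (simp only: gram_form G_def B_sum)
    finally show "0 \<le> Re (\<Sum>i<m. \<Sum>j<m. G (x i) (x j) * h j * cnj (h i))"
      using G_self[of ?u] by simp
  qed (use M in auto)
  also have "(\<Sum>i<m. \<Sum>j<m. M $$ (i, j) * G (x j) (x i)) = complex_of_real a * coeff_form m M x x
      - (\<Sum>\<alpha>\<in>?W. coeff_form m M (\<lambda>i. B \<alpha> (x i)) (\<lambda>i. B \<alpha> (x i)))"
  proof -
    have "(\<Sum>i<m. \<Sum>j<m. \<Sum>\<alpha>\<in>?W. M $$ (i, j) * cinner (B \<alpha> (x j)) (B \<alpha> (x i))) =
      (\<Sum>\<alpha>\<in>?W. coeff_form m M (\<lambda>i. B \<alpha> (x i)) (\<lambda>i. B \<alpha> (x i)))"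
      by (simp only: sum.swap[of _ _ ?W] coeff_form_def)
    then show ?thesis
      by (simp add: coeff_form_def G_def right_diff_distrib sum_subtractf sum_distrib_left
          mult.left_commute)
  qed
  finally show ?thesis
    by simp
qed

lemma homogeneous_part_le:
  fixes p :: "'n::finite list \<Rightarrow> complex mat" and A :: "'n \<Rightarrow> 'h::chilbert \<Rightarrow>\<^sub>L 'h"
  assumes K: "infinite_cdim TYPE('k::chilbert)" and p: "p \<in> nc_polys m"
    and pos: "\<And>(X :: 'n \<Rightarrow> 'k \<Rightarrow>\<^sub>L 'k) x. X \<in> open_row_ball \<Longrightarrow> 0 \<le> Re (poly_form m p X x)"
    and A: "\<And>i. A i \<in> bop" and k: "1 \<le> k" and u: "0 < u" "u < 1"
    and C: "row_norm A k \<le> C * (u ^ 4) ^ k"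
  shows "(\<Sum>\<alpha> | length \<alpha> = k. Re (coeff_form m (p \<alpha>) (\<lambda>i. blinfun_apply (word_op A \<alpha>) (x i)) x))
    \<le> (1 + C) * u ^ k * Re (coeff_form m (p []) x x)"
proof -
  define B where "B \<alpha> = blinfun_apply (op_adj (word_op A \<alpha>))" for \<alpha>
  \<comment> \<open>With s = u^(-2k) the quadratic term costs s^2 C u^(4k) = C times the constant
    term, while the linear term has weight s u^k = u^(-k). Multiplying by u^k leaves the decay u^k
    in the conclusion.\<close>
  define s where "s = 1 / (u ^ k * u ^ k)"
  \<comment> \<open>The minus sign moves the sum to be bounded to the smaller side of the
    inequality; the adjoint is moved over to the first argument as A_\<alpha>.\<close>
  define y where "y \<alpha> = (if \<alpha> = [] then x else (\<lambda>i. complex_of_real (- s) *\<^sub>C B \<alpha> (x i)))" for \<alpha>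
  let ?W = "{\<alpha> :: 'n list. length \<alpha> = k}"
  let ?Q = "\<lambda>x. Re (coeff_form m (p []) x x)"
  let ?P = "\<Sum>\<alpha>\<in>?W. Re (coeff_form m (p \<alpha>) (\<lambda>i. blinfun_apply (word_op A \<alpha>) (x i)) x)"
  have not_Nil: "\<alpha> \<noteq> []" if "\<alpha> \<in> ?W" for \<alpha>
    using that k by auto
  have "0 \<le> ?Q (y []) + (\<Sum>\<alpha>\<in>?W. ?Q (y \<alpha>)) + u ^ k * (\<Sum>\<alpha>\<in>?W. Re (coeff_form m (p \<alpha>) (y []) (y \<alpha>)))"
    by (rule homogeneous_part_pos[OF K p pos k u])
  also have "?Q (y []) = ?Q x"
    by (simp add: y_def)
  also have "(\<Sum>\<alpha>\<in>?W. ?Q (y \<alpha>)) = s * s * (\<Sum>\<alpha>\<in>?W. ?Q (\<lambda>i. B \<alpha> (x i)))"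
    unfolding sum_distrib_left
    by (rule sum.cong) (simp_all add: y_def not_Nil coeff_form_scale)
  also have "(\<Sum>\<alpha>\<in>?W. Re (coeff_form m (p \<alpha>) (y []) (y \<alpha>))) = - s * ?P"
    unfolding sum_distrib_left
  proof (rule sum.cong[OF refl])
    fix \<alpha> assume \<alpha>: "\<alpha> \<in> ?W"
    have "coeff_form m (p \<alpha>) (y []) (y \<alpha>) =
        complex_of_real (- s) * coeff_form m (p \<alpha>) x (\<lambda>i. B \<alpha> (x i))"
      using coeff_form_scale[of m "p \<alpha>" 1 x "complex_of_real (- s)"] not_Nil[OF \<alpha>] by (simp add: y_def)
    also have "coeff_form m (p \<alpha>) x (\<lambda>i. B \<alpha> (x i)) =
        coeff_form m (p \<alpha>) (\<lambda>i. blinfun_apply (word_op A \<alpha>) (x i)) x"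
      by (simp add: coeff_form_def B_def op_adj[OF word_op_bop[OF A]])
    finally show "Re (coeff_form m (p \<alpha>) (y []) (y \<alpha>)) =
        - s * Re (coeff_form m (p \<alpha>) (\<lambda>i. blinfun_apply (word_op A \<alpha>) (x i)) x)"
      by simp
  qed
  finally have "s * u ^ k * ?P \<le> ?Q x + s * s * (\<Sum>\<alpha>\<in>?W. ?Q (\<lambda>i. B \<alpha> (x i)))"
    by (simp add: mult_ac)
  also have "\<dots> \<le> ?Q x + s * s * (C * (u ^ 4) ^ k * ?Q x)"
    unfolding B_def
    by (intro add_left_mono mult_left_mono coeff_form_row_le A C)
      (use constant_coeff_scalar_nonneg[OF K p pos] in auto)
  also have "s * s * (C * (u ^ 4) ^ k * ?Q x) = C * ?Q x"
  proof -
    have "(u ^ 4) ^ k = u ^ k * u ^ k * (u ^ k * u ^ k)"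
    proof -
      have "(u ^ 4) ^ k = (u ^ k) ^ 4"
        by (simp only: power_mult[symmetric] mult.commute)
      then show ?thesis
        by (simp only: power4_eq_xxxx mult.assoc)
    qed
    then have "s * s * (u ^ 4) ^ k = 1"
      using u by (simp add: s_def)
    then have "C * ?Q x * (s * s * (u ^ 4) ^ k) = C * ?Q x"
      by simp
    then show ?thesis
      by (simp only: mult_ac)
  qed
  finally have "u ^ k * (s * u ^ k * ?P) \<le> u ^ k * ((1 + C) * ?Q x)"
    using u by (intro mult_left_mono) (auto simp: distrib_right)
  moreover have "u ^ k * (s * u ^ k * ?P) = ?P"
    using u by (simp add: s_def)
  ultimately show ?thesis
    by (simp only: mult_ac)
qed

lemma harnack_of_jsr:
  fixes A :: "'n::finite \<Rightarrow> 'h::chilbert \<Rightarrow>\<^sub>L 'h"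
  assumes \<rho>: "\<rho> > 0" and K: "infinite_cdim TYPE('k::chilbert)" and A: "\<And>i. A i \<in> bop"
    and jsr: "joint_spectral_radius A < 1"
  shows "harnack_dominated TYPE('k) \<rho> A (\<lambda>_. 0)"
proof -
  obtain C t where C: "0 < C" and t: "0 < t" "t < 1" and row: "\<And>k. row_norm A k \<le> C * t ^ k"
    by (rule row_norm_exp_bound[OF A jsr]) (rule that; assumption)
  \<comment> \<open>The exponent 4 matches the row bound required by
    \<open>homogeneous_part_le\<close>.\<close>
  define u where "u = root 4 t"
  have u: "0 < u" "u < 1" "u ^ 4 = t"
    using t by (simp_all add: u_def)
  \<comment> \<open>Sum over all degrees of the bounds (1 + C) u^k, each a multiple of the constant
    term q.\<close>
  define D where "D = (1 + C) / (1 - u)"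
  have D: "0 < D"
    using C u by (simp add: D_def)
  \<comment> \<open>The left side of domination is at most q + D q + (rho - 1) q = (rho + D) q and
    the form at 0 is rho q, which dictates c^2 rho = rho + D.\<close>
  define c where "c = sqrt ((\<rho> + D) / \<rho>)"
  have c: "0 < c" "c\<^sup>2 * \<rho> = \<rho> + D"
    using \<rho> D by (simp_all add: c_def)
  have "Re (poly_form m p A x) + (\<rho> - 1) * Re (poly_form m p (\<lambda>_. 0) x)
      \<le> c\<^sup>2 * (\<rho> * Re (poly_form m p (\<lambda>_. 0) x))"
    if p: "p \<in> nc_polys m"
      and pos: "\<And>(X :: 'n \<Rightarrow> 'k \<Rightarrow>\<^sub>L 'k) x. X \<in> open_row_ball \<Longrightarrow> 0 \<le> Re (poly_form m p X x)"
    for m p x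
  proof -
    let ?q = "Re (coeff_form m (p []) x x)"
    let ?P = "\<lambda>\<alpha>. Re (coeff_form m (p \<alpha>) (\<lambda>i. blinfun_apply (word_op A \<alpha>) (x i)) x)"
    have q: "0 \<le> ?q"
      by (rule coeff_form_nonneg[OF constant_coeff_scalar_nonneg[OF K p pos]])
    have zero: "Re (poly_form m p (\<lambda>_. 0) x) = ?q"
      by (simp add: poly_form_zero[OF p] coeff_form_def)
    have "finite {\<alpha>. p \<alpha> \<noteq> 0\<^sub>m m m}"
      using p by (simp add: nc_polys_def)
    then obtain N where N: "\<And>\<alpha>. p \<alpha> \<noteq> 0\<^sub>m m m \<Longrightarrow> length \<alpha> \<le> N"
      using finite_nat_set_iff_bounded_le[of "length ` {\<alpha>. p \<alpha> \<noteq> 0\<^sub>m m m}"] by auto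
    have "poly_form m p A x = (\<Sum>\<alpha> | length \<alpha> \<le> N.
        coeff_form m (p \<alpha>) (\<lambda>i. blinfun_apply (word_op A \<alpha>) (x i)) x)"
      unfolding coeff_form_def by (rule poly_form_superset[OF finite_words_le]) (use N in auto)
    then have "Re (poly_form m p A x) = (\<Sum>\<alpha> | length \<alpha> \<le> N. ?P \<alpha>)"
      by simp
    also have "\<dots> = ?P [] + (\<Sum>\<alpha>\<in>{\<alpha>. length \<alpha> \<le> N} - {[]}. ?P \<alpha>)"
      by (rule sum.remove[OF finite_words_le]) simp
    also have "\<dots> = ?q + (\<Sum>k=1..N. \<Sum>\<alpha> | length \<alpha> = k. ?P \<alpha>)"
      by (simp add: sum_words_by_length)
    also have "\<dots> \<le> ?q + (\<Sum>k=1..N. (1 + C) * u ^ k * ?q)"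
      by (intro add_left_mono sum_mono homogeneous_part_le[OF K p pos A _ u(1,2)])
        (use row u in auto)
    also have "(\<Sum>k=1..N. (1 + C) * u ^ k * ?q) = (\<Sum>k=1..N. u ^ k) * ((1 + C) * ?q)"
      unfolding sum_distrib_right by (simp only: mult_ac)
    also have "\<dots> \<le> 1 / (1 - u) * ((1 + C) * ?q)"
    proof (rule mult_right_mono)
      have "(\<Sum>k=1..N. u ^ k) \<le> (\<Sum>k. u ^ k)"
        using u by (intro sum_le_suminf summable_geometric) auto
      then show "(\<Sum>k=1..N. u ^ k) \<le> 1 / (1 - u)"
        using u suminf_geometric[of u] by simp
    qed (use C q in simp)
    finally have "Re (poly_form m p A x) \<le> ?q + D * ?q"
      by (simp add: D_def)
    then have "Re (poly_form m p A x) + (\<rho> - 1) * ?q \<le> (\<rho> + D) * ?q"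
      by (simp add: algebra_simps)
    then show ?thesis
      by (simp only: zero c(2)[symmetric] mult.assoc)
  qed
  with c(1) show ?thesis
    unfolding harnack_dominated_zero_iff[OF A] by blast
qed

theorem theorem2p5:
  fixes \<rho> :: real and A :: "'n::finite \<Rightarrow> 'h::chilbert \<Rightarrow>\<^sub>L 'h"
  assumes "\<rho> > 0"
    and "infinite_cdim TYPE('k::chilbert)"
    and "A \<in> class_C TYPE('g::chilbert) \<rho>"
  shows "harnack_dominated TYPE('k) \<rho> A (\<lambda>_. 0) \<longleftrightarrow> joint_spectral_radius A < 1"
proof
  show "joint_spectral_radius A < 1" if "harnack_dominated TYPE('k) \<rho> A (\<lambda>_. 0)"
    using jsr_of_harnack[OF assms(1,3) that] .
  have "A i \<in> bop" for i
    using assms(3) by (simp add: class_C_def)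
  then show "harnack_dominated TYPE('k) \<rho> A (\<lambda>_. 0)" if "joint_spectral_radius A < 1"
    using harnack_of_jsr[OF assms(1,2) _ that] by blast
qed

end
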